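(* Let $\rho$ be the optimized certainty equivalent associated with $\phi$, and $\alpha$ its induced divergence. If $y\phi^*(x)+x\phi^*(y)\le\phi^*(xy)$ for all $x,y\ge0$, then $\alpha$ is superadditive, or equivalently $\rho$ is acceptance consistent. If $y\phi^*(x)+x\phi^*(y)\ge\phi^*(xy)$ for all $x,y\ge0$, then $\alpha$ is subadditive, or equivalently $\rho$ is rejection consistent.
   Context: $(\Omega,\mathcal F,P)$ is a fixed nonatomic standard Borel probability space, $L^\infty=L^\infty(\Omega,\mathcal F,P)$. Let $\phi:\mathbb R\to\mathbb R$ be convex and nondecreasing with $\phi^*(1)=0$, where $\phi^*(y)=\sup_{x\in\mathbb R}(xy-\phi(x))$ is its convex conjugate. The optimized certainty equivalent is $\rho(X)=\inf_{m\in\mathbb R}(\mathbb E[\phi(m+X)]-m)$ for $X\in L^\infty$, a law invariant risk measure. For Polish $E$ and $\mu\in\mathcal P(E)$ (Borel probability measures), $\rho_\mu(f):=\rho(f(X))$ for bounded measurable $f$, where $X:\Omega\to E$ has law $\mu$; the induced divergence $\alpha(\nu|\mu):=\sup_{f}(\int f\,d\nu-\rho_\mu(f))$ equals the $\phi^*$-divergence $\int\phi^*(d\nu/d\mu)\,d\mu$ for $\nu\ll\mu$ and $\infty$ otherwise (and is jointly measurable). For Polish $E,F$, $\mu(dx)K_x(dy)$ denotes the measure on $E\times F$ built from $\mu\in\mathcal P(E)$ and a measurable map $x\mapsto K_x\in\mathcal P(F)$; every element of $\mathcal P(E\times F)$ has this form. $\alpha$ is superadditive if $\alpha(\nu(dx)K^\nu_x(dy)\,|\,\mu(dx)K^\mu_x(dy))\ge\alpha(\nu|\mu)+\int\nu(dx)\alpha(K^\nu_x|K^\mu_x)$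 for all Polish $E,F$ and all such measures, subadditive if always $\le$. With $\tilde\rho(P\circ X^{-1}):=\rho(X)$ and $\rho(X|\mathcal G):=\tilde\rho(P(X\in\cdot\,|\,\mathcal G))$ for a sub-$\sigma$-field $\mathcal G$ (regular conditional law), $\rho$ is acceptance consistent if $\rho(X)\le\rho(\rho(X|\mathcal G))$ for all $X\in L^\infty$ and all $\mathcal G$, and rejection consistent if $\ge$. *)

theory Defs
  imports "HOL-Probability.Probability"
begin

definition conj_fun :: "(real \<Rightarrow> real) \<Rightarrow> real \<Rightarrow> ereal" where
  "conj_fun \<phi> y = (SUP x. ereal (x * y - \<phi> x))"

text \<open>Optimized certainty equivalent of the random variable f on the probability
  space M: inf over m of E[phi(m + f)] - m.  Used both for rho(X) on the base space
  and, by law invariance, for rho_mu(f) = rho(f(X)) with X of law mu.\<close>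
definition oce :: "(real \<Rightarrow> real) \<Rightarrow> 'e measure \<Rightarrow> ('e \<Rightarrow> real) \<Rightarrow> real" where
  "oce \<phi> \<mu> f = (INF m::real. (\<integral>x. \<phi> (m + f x) \<partial>\<mu>) - m)"

definition ind_div :: "(real \<Rightarrow> real) \<Rightarrow> 'e::topological_space measure \<Rightarrow> 'e measure \<Rightarrow> ereal" where
  "ind_div \<phi> \<nu> \<mu> =
     (SUP f \<in> {f :: 'e \<Rightarrow> real. f \<in> borel_measurable borel \<and> bounded (range f)}.
        ereal ((\<integral>x. f x \<partial>\<nu>) - oce \<phi> \<mu> f))"

definition prob_on :: "'e::topological_space measure \<Rightarrow> bool" where
  "prob_on \<mu> \<longleftrightarrow> prob_space \<mu> \<and> sets \<mu> = sets (borel :: 'e measure)"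

definition kernel_on :: "('e::topological_space \<Rightarrow> 'f::topological_space measure) \<Rightarrow> bool" where
  "kernel_on K \<longleftrightarrow> K \<in> (borel :: 'e measure) \<rightarrow>\<^sub>M subprob_algebra (borel :: 'f measure)
     \<and> (\<forall>x. prob_space (K x))"

definition mix :: "'e::topological_space measure \<Rightarrow> ('e \<Rightarrow> 'f::topological_space measure)
     \<Rightarrow> ('e \<times> 'f) measure" where
  "mix \<mu> K = \<mu> \<bind> (\<lambda>x. K x \<bind> (\<lambda>y. return (borel :: ('e \<times> 'f) measure) (x, y)))"

text \<open>Super-/subadditivity for the Polish spaces given by the types 'e and 'f.
  The divergence is nonnegative (f = 0 in its definition, phi*(1) = 0), so the
  integral of x \<mapsto> alpha(K^nu_x|K^mu_x) is taken as a nonnegative integral.\<close>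
definition div_superadditive :: "(real \<Rightarrow> real) \<Rightarrow> 'e::polish_space itself \<Rightarrow> 'f::polish_space itself \<Rightarrow> bool" where
  "div_superadditive \<phi> _ _ \<longleftrightarrow>
     (\<forall>(\<mu>::'e measure) (\<nu>::'e measure) (K\<mu>::'e \<Rightarrow> 'f measure) (K\<nu>::'e \<Rightarrow> 'f measure).
        prob_on \<mu> \<longrightarrow> prob_on \<nu> \<longrightarrow> kernel_on K\<mu> \<longrightarrow> kernel_on K\<nu> \<longrightarrow>
        ind_div \<phi> (mix \<nu> K\<nu>) (mix \<mu> K\<mu>)
          \<ge> ind_div \<phi> \<nu> \<mu> + enn2ereal (\<integral>\<^sup>+ x. e2ennreal (ind_div \<phi> (K\<nu> x) (K\<mu> x)) \<partial>\<nu>))"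

definition div_subadditive :: "(real \<Rightarrow> real) \<Rightarrow> 'e::polish_space itself \<Rightarrow> 'f::polish_space itself \<Rightarrow> bool" where
  "div_subadditive \<phi> _ _ \<longleftrightarrow>
     (\<forall>(\<mu>::'e measure) (\<nu>::'e measure) (K\<mu>::'e \<Rightarrow> 'f measure) (K\<nu>::'e \<Rightarrow> 'f measure).
        prob_on \<mu> \<longrightarrow> prob_on \<nu> \<longrightarrow> kernel_on K\<mu> \<longrightarrow> kernel_on K\<nu> \<longrightarrow>
        ind_div \<phi> (mix \<nu> K\<nu>) (mix \<mu> K\<mu>)
          \<le> ind_div \<phi> \<nu> \<mu> + enn2ereal (\<integral>\<^sup>+ x. e2ennreal (ind_div \<phi> (K\<nu> x) (K\<mu> x)) \<partial>\<nu>))"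

definition nonatomic :: "'a measure \<Rightarrow> bool" where
  "nonatomic M \<longleftrightarrow> (\<forall>A \<in> sets M. measure M A > 0 \<longrightarrow>
      (\<exists>B \<in> sets M. B \<subseteq> A \<and> 0 < measure M B \<and> measure M B < measure M A))"

text \<open>Bounded random variables (representatives of elements of L-infinity).\<close>
definition Linf :: "'a measure \<Rightarrow> ('a \<Rightarrow> real) \<Rightarrow> bool" where
  "Linf M X \<longleftrightarrow> X \<in> borel_measurable M \<and> bounded (X ` space M)"

definition reg_cond_law :: "'a measure \<Rightarrow> 'a measure \<Rightarrow> ('a \<Rightarrow> real) \<Rightarrow> ('a \<Rightarrow> real measure) \<Rightarrow> bool" where
  "reg_cond_law M G X K \<longleftrightarrow>
     (\<forall>\<omega> \<in> space M. prob_space (K \<omega>) \<and> sets (K \<omega>) = sets (borel :: real measure))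
   \<and> (\<forall>B \<in> sets (borel :: real measure). (\<lambda>\<omega>. measure (K \<omega>) B) \<in> borel_measurable G)
   \<and> (\<forall>A \<in> sets G. \<forall>B \<in> sets (borel :: real measure).
        (\<integral>\<omega>. indicator A \<omega> * measure (K \<omega>) B \<partial>M) = measure M (A \<inter> X -` B \<inter> space M))"

text \<open>rho(X|G)(omega) = rho~(P(X \<in> . | G)(omega)), rho~(law) = OCE of the identity under the law.\<close>
definition cond_oce :: "(real \<Rightarrow> real) \<Rightarrow> ('a \<Rightarrow> real measure) \<Rightarrow> 'a \<Rightarrow> real" where
  "cond_oce \<phi> K \<omega> = oce \<phi> (K \<omega>) (\<lambda>x. x)"

definition acceptance_consistent :: "(real \<Rightarrow> real) \<Rightarrow> 'a measure \<Rightarrow> bool" where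
  "acceptance_consistent \<phi> M \<longleftrightarrow> (\<forall>X G K. Linf M X \<longrightarrow> subalgebra M G \<longrightarrow> reg_cond_law M G X K
      \<longrightarrow> oce \<phi> M X \<le> oce \<phi> M (cond_oce \<phi> K))"

definition rejection_consistent :: "(real \<Rightarrow> real) \<Rightarrow> 'a measure \<Rightarrow> bool" where
  "rejection_consistent \<phi> M \<longleftrightarrow> (\<forall>X G K. Linf M X \<longrightarrow> subalgebra M G \<longrightarrow> reg_cond_law M G X K
      \<longrightarrow> oce \<phi> M X \<ge> oce \<phi> M (cond_oce \<phi> K))"

end

(*
  Everything follows from a pointwise comparison. Let f be bounded and m real.

  If y phi*(x) + x phi*(y) <= phi*(xy), then E phi(m + f) <= phi(m + oce f): let Y be the subgradient
  of phi along m + f and write Y = a Z with a = E Y; splitting phi*(a Z) by the hypothesis yields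
  E phi(m + f) <= a m + a (E Z f - E phi*(Z)) - phi*(a) <= a (m + oce f) - phi*(a).
  If the reverse inequality holds, then E phi(m + f) >= phi(m + oce f): take a to be the subgradient at
  m + oce f and Z a nearly optimal density in the dual representation of oce f, and bound
  phi(m + f) >= a Z (m + f) - phi*(a Z).

  Applied to the fibres of a disintegration and integrated, this compares oce with the iterated oce,
  which is acceptance (rejection) consistency for conditional laws and for products mu(dx) K_x(dy).
  For subadditivity a test function f on the product is decomposed as f = g + (f - g) with
  g(x) = oce of f(x, .) under K_x. For superadditivity f(x, y) = g(x) + H(x, y) is glued from
  a test function g and nearly optimal test functions H(x, .) with oce 0, selected measurably
  from a countable family in which the divergence is already attained as a supremum.
*)
theory Submission
  imports Defs
begin

section \<open>The pointwise comparison\<close>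

text \<open>The multiplicative conditions reflect the chain rule for densities. If z is the density
  of nu with respect to mu and k_x that of K^nu_x with respect to K^mu_x, the joint density is the
  product z k, and k phi*(z) + z phi*(k) integrates to alpha(nu|mu) + \<integral>
  alpha(K^nu_x|K^mu_x) nu(dx). The proof itself never passes through the formula for alpha as a
  phi*-divergence: it stays with test functions. Two obstacles shape it. The conjugate may be
  infinite and the infimum over m need not be attained; so a conjugate is either evaluated at a
  subgradient, where it is finite, or compared with the values p y - phi(p) at single points p, and
  optimizers are replaced by nearly optimal ones. Superadditivity moreover needs one test function
  on the product whose fibres are nearly optimal simultaneously, a measurable selection problem;
  reducing the divergence to countably many test functions makes it elementary.\<close>

locale oce_function =
  fixes \<phi> :: "real \<Rightarrow> real"
  assumes convex: "convex_on UNIV \<phi>"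
    and mono: "mono \<phi>"
    and conj_one: "conj_fun \<phi> 1 = 0"
begin

section \<open>Subgradients of phi and its conjugate\<close>

lemma ge_self: "x \<le> \<phi> x"
proof -
  have "ereal (x * 1 - \<phi> x) \<le> conj_fun \<phi> 1"
    unfolding conj_fun_def by (rule SUP_upper) simp
  then show ?thesis by (simp add: conj_one zero_ereal_def)
qed

text \<open>Only approximate, since the supremum phi*(1) = 0 need not be attained: phi(x) = log (1 +
  exp x) is an example.\<close>

lemma near_self:
  assumes "\<epsilon> > 0"
  obtains x where "\<phi> x < x + \<epsilon>"
proof -
  have "ereal (- \<epsilon>) < conj_fun \<phi> 1"
    using assms by (simp add: conj_one zero_ereal_def)
  then obtain x where "ereal (- \<epsilon>) < ereal (x * 1 - \<phi> x)"
    unfolding conj_fun_def less_SUP_iff by blast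
  then show ?thesis by (intro that[of x]) simp
qed

lemma measurable [measurable]: "\<phi> \<in> borel_measurable borel"
  by (rule borel_measurable_mono[OF mono])

text \<open>An arbitrary subgradient at each point. Whatever the choice, it is monotone in the
  point, hence Borel measurable, so it can be integrated along \<open>m + f\<close>.\<close>

definition slope :: "real \<Rightarrow> real" where
  "slope x = (SOME s. \<forall>y. \<phi> x + s * (y - x) \<le> \<phi> y)"

lemma above_tangent: "\<phi> x + slope x * (y - x) \<le> \<phi> y"
proof -
  have "\<exists>s. \<forall>y. \<phi> x + s * (y - x) \<le> \<phi> y"
    using convex_le_Inf_differential[OF convex, of x] by auto
  then have "\<forall>y. \<phi> x + slope x * (y - x) \<le> \<phi> y"
    unfolding slope_def by (rule someI_ex)
  then show ?thesis by blast
qed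

lemma slope_nonneg: "0 \<le> slope x"
proof -
  have "\<phi> (x - 1) \<le> \<phi> x" using mono by (auto simp: mono_def)
  with above_tangent[of x "x - 1"] show ?thesis by simp
qed

lemma slope_mono: "mono slope"
proof (rule monoI)
  fix x y :: real assume "x \<le> y"
  show "slope x \<le> slope y"
  proof (cases "x = y")
    case False
    with \<open>x \<le> y\<close> have "y - x > 0" by simp
    have "slope x * (y - x) \<le> slope y * (y - x)"
      using above_tangent[of x y] above_tangent[of y x] by (simp add: algebra_simps)
    with \<open>y - x > 0\<close> show ?thesis by simp
  qed simp
qed

lemma slope_measurable [measurable]: "slope \<in> borel_measurable borel"
  by (rule borel_measurable_mono[OF slope_mono])

lemma conj_ge: "ereal (p * y - \<phi> p) \<le> conj_fun \<phi> y"
  unfolding conj_fun_def by (rule SUP_upper) simp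

lemma conj_le:
  assumes "\<And>p. p * y - \<phi> p \<le> w"
  shows "conj_fun \<phi> y \<le> ereal w"
  unfolding conj_fun_def by (rule SUP_least) (simp add: assms)

text \<open>The equality case of Young's inequality. It identifies points where the conjugate is
  finite.\<close>

lemma conj_slope: "conj_fun \<phi> (slope u) = ereal (u * slope u - \<phi> u)"
proof (rule antisym[OF conj_le conj_ge])
  fix p show "p * slope u - \<phi> p \<le> u * slope u - \<phi> u"
    using above_tangent[of u p] by (simp add: algebra_simps)
qed

text \<open>The two conjugates on the smaller side are bounded below at arbitrary points
  \<open>p\<close> and \<open>q\<close>; the one on the larger side sits at a slope and is therefore
  an explicit real number. This removes \<open>ereal\<close> from the later integrations.\<close>

lemma supermultiplicative_primal:
  assumes H: "\<And>x y. 0 \<le> x \<Longrightarrow> 0 \<le> y \<Longrightarrow>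
      ereal y * conj_fun \<phi> x + ereal x * conj_fun \<phi> y \<le> conj_fun \<phi> (x * y)"
    and "0 \<le> z" "0 \<le> a" and az: "z * a = slope u"
  shows "a * (p * z - \<phi> p) + z * (q * a - \<phi> q) \<le> u * slope u - \<phi> u"
proof -
  have "ereal (a * (p * z - \<phi> p) + z * (q * a - \<phi> q))
      = ereal a * ereal (p * z - \<phi> p) + ereal z * ereal (q * a - \<phi> q)" by simp
  also have "\<dots> \<le> ereal a * conj_fun \<phi> z + ereal z * conj_fun \<phi> a"
    using assms by (intro add_mono ereal_mult_left_mono conj_ge) auto
  also have "\<dots> \<le> conj_fun \<phi> (slope u)" using H[of z a] assms by simp
  finally show ?thesis by (simp add: conj_slope)
qed

text \<open>Now the sum of conjugates is the larger side and needs upper bounds: at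
  \<open>slope c\<close> the value is explicit, at \<open>z\<close> a majorant \<open>w\<close> is
  supplied.\<close>

lemma submultiplicative_primal:
  assumes H: "\<And>x y. 0 \<le> x \<Longrightarrow> 0 \<le> y \<Longrightarrow>
      conj_fun \<phi> (x * y) \<le> ereal y * conj_fun \<phi> x + ereal x * conj_fun \<phi> y"
    and "0 \<le> z" and w: "\<And>p. p * z - \<phi> p \<le> w"
  shows "u * (z * slope c) - \<phi> u \<le> slope c * w + z * (c * slope c - \<phi> c)"
proof -
  have "ereal (u * (z * slope c) - \<phi> u) \<le> conj_fun \<phi> (z * slope c)" by (rule conj_ge)
  also have "\<dots> \<le> ereal (slope c) * conj_fun \<phi> z + ereal z * conj_fun \<phi> (slope c)"
    using H[of z "slope c"] assms slope_nonneg by simp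
  also have "\<dots> \<le> ereal (slope c) * ereal w + ereal z * ereal (c * slope c - \<phi> c)"
    using \<open>0 \<le> z\<close> slope_nonneg w
    by (simp add: conj_slope del: times_ereal.simps plus_ereal.simps)
      (intro add_mono ereal_mult_left_mono conj_le order_refl; simp)
  finally show ?thesis by simp
qed

lemma abs_bound:
  assumes "\<bar>t\<bar> \<le> C"
  shows "\<bar>\<phi> (m + t)\<bar> \<le> \<bar>\<phi> (m - C)\<bar> + \<bar>\<phi> (m + C)\<bar>"
proof -
  have "\<phi> (m - C) \<le> \<phi> (m + t)" "\<phi> (m + t) \<le> \<phi> (m + C)"
    using assms by (auto intro!: monoD[OF mono])
  then show ?thesis by linarith
qed

lemma slope_bound:
  assumes "\<bar>t\<bar> \<le> C"
  shows "\<bar>slope (m + t)\<bar> \<le> slope (m + C)"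
  using assms slope_nonneg by (auto intro!: monoD[OF slope_mono])

text \<open>Slopes on the interval are at most the slope at its right end. This turns L1-closeness
  of test functions into closeness of their certainty equivalents.\<close>

lemma local_lipschitz:
  assumes "\<bar>s\<bar> \<le> C" "\<bar>t\<bar> \<le> C"
  shows "\<phi> (m + s) - \<phi> (m + t) \<le> slope (m + C) * \<bar>s - t\<bar>"
proof -
  have "\<phi> (m + s) - \<phi> (m + t) \<le> slope (m + s) * (s - t)"
    using above_tangent[of "m + s" "m + t"] by (simp add: algebra_simps)
  also have "\<dots> \<le> slope (m + s) * \<bar>s - t\<bar>"
    by (intro mult_left_mono slope_nonneg) auto
  also have "\<dots> \<le> slope (m + C) * \<bar>s - t\<bar>"
    using assms by (intro mult_right_mono monoD[OF slope_mono]) auto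
  finally show ?thesis .
qed

end

section \<open>Bounded functions under a single probability measure\<close>

locale oce_function_prob = oce_function \<phi> + prob_space P
  for \<phi> :: "real \<Rightarrow> real" and P :: "'e measure" +
  fixes f :: "'e \<Rightarrow> real" and C :: real
  assumes f_measurable [measurable]: "f \<in> borel_measurable P"
    and f_bound: "\<And>x. x \<in> space P \<Longrightarrow> \<bar>f x\<bar> \<le> C"
begin

lemma f_integrable [simp]: "integrable P f"
  using f_bound by (intro integrable_const_bound[where B = C]) auto

lemma phi_integrable [simp]: "integrable P (\<lambda>x. \<phi> (m + f x))"
  using abs_bound[OF f_bound]
  by (intro integrable_const_bound[where B = "\<bar>\<phi> (m - C)\<bar> + \<bar>\<phi> (m + C)\<bar>"]) auto

lemma slope_integrable [simp]: "integrable P (\<lambda>x. slope (m + f x))"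
  using slope_bound[OF f_bound]
  by (intro integrable_const_bound[where B = "slope (m + C)"]) auto

lemma slope_f_integrable [simp]: "integrable P (\<lambda>x. slope (m + f x) * f x)"
proof (intro integrable_const_bound[where B = "slope (m + C) * C"] AE_I2)
  fix x assume "x \<in> space P"
  then show "norm (slope (m + f x) * f x) \<le> slope (m + C) * C"
    using slope_bound[OF f_bound, of x m] f_bound[of x] slope_nonneg
    by (auto simp: abs_mult intro!: mult_mono)
qed simp

lemma objective_ge: "expectation f \<le> expectation (\<lambda>x. \<phi> (m + f x)) - m"
proof -
  have "expectation (\<lambda>x. m + f x) \<le> expectation (\<lambda>x. \<phi> (m + f x))"
    by (intro integral_mono ge_self) auto
  then show ?thesis by (simp add: prob_space)
qed

lemma objective_bdd_below: "bdd_below (range (\<lambda>m. expectation (\<lambda>x. \<phi> (m + f x)) - m))"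
  using objective_ge by (auto intro!: bdd_belowI)

lemma oce_le: "oce \<phi> P f \<le> expectation (\<lambda>x. \<phi> (m + f x)) - m"
  unfolding oce_def by (rule cINF_lower[OF objective_bdd_below]) simp

lemma oce_ge_expectation: "expectation f \<le> oce \<phi> P f"
  unfolding oce_def by (rule cINF_greatest) (use objective_ge in auto)

lemma oce_bound: "\<bar>oce \<phi> P f\<bar> \<le> C"
proof -
  have "oce \<phi> P f \<le> C"
  proof (rule field_le_epsilon)
    fix e :: real assume "e > 0"
    then obtain x where x: "\<phi> x < x + e" by (rule near_self)
    \<comment> \<open>The shift \<open>x - C\<close> keeps \<open>x - C + f\<close> below
      \<open>x\<close>, so the objective there is at most \<open>\<phi> x - (x - C)\<close>, which
      is less than \<open>C + e\<close>.\<close>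
    have "expectation (\<lambda>t. \<phi> ((x - C) + f t)) \<le> expectation (\<lambda>t. \<phi> x)"
      using f_bound by (intro integral_mono monoD[OF mono]) (auto simp: abs_le_iff)
    then show "oce \<phi> P f \<le> C + e"
      using oce_le[of "x - C"] x by (simp add: prob_space)
  qed
  moreover have "- C \<le> expectation f"
  proof -
    have "expectation (\<lambda>x. - C) \<le> expectation f"
      using f_bound by (intro integral_mono) (fastforce simp: abs_le_iff)+
    then show ?thesis by (simp add: prob_space)
  qed
  ultimately show ?thesis using oce_ge_expectation by linarith
qed

lemma near_oce:
  assumes "\<epsilon> > 0"
  obtains m where "expectation (\<lambda>x. \<phi> (m + f x)) - m < oce \<phi> P f + \<epsilon>"
proof -
  have "(INF m. expectation (\<lambda>x. \<phi> (m + f x)) - m) < oce \<phi> P f + \<epsilon>"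
    using assms by (simp add: oce_def)
  then show ?thesis
    using that by (subst (asm) cINF_less_iff) (auto simp: objective_bdd_below)
qed

lemma expectation_le_of_supermultiplicative:
  assumes H: "\<And>x y. 0 \<le> x \<Longrightarrow> 0 \<le> y \<Longrightarrow>
      ereal y * conj_fun \<phi> x + ereal x * conj_fun \<phi> y \<le> conj_fun \<phi> (x * y)"
  shows "expectation (\<lambda>x. \<phi> (m + f x)) \<le> \<phi> (m + oce \<phi> P f)"
proof -
  define Y where "Y = (\<lambda>x. slope (m + f x))"
  define a where "a = expectation Y"
  define q where "q = m + oce \<phi> P f"
  have Y [simp]: "integrable P Y" by (simp add: Y_def)
  have Y0: "0 \<le> Y x" for x by (simp add: Y_def slope_nonneg)
  have "0 \<le> a" unfolding a_def by (intro integral_nonneg_AE) (simp add: Y0)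
  show ?thesis
  \<comment> \<open>A vanishing mean slope cannot be normalized to a density, but then
    \<open>\<phi> (m + f x)\<close> is almost surely the minimum of phi.\<close>
  proof (cases "a = 0")
    case True
    then have "AE x in P. Y x = 0"
      using integral_nonneg_eq_0_iff_AE[OF Y] Y0 by (simp add: a_def)
    then have "AE x in P. \<phi> (m + f x) \<le> \<phi> q"
    proof eventually_elim
      case (elim x)
      then show ?case using above_tangent[of "m + f x" q] by (simp add: Y_def)
    qed
    then have "expectation (\<lambda>x. \<phi> (m + f x)) \<le> expectation (\<lambda>x. \<phi> q)"
      by (intro integral_mono_AE) auto
    then show ?thesis by (simp add: prob_space q_def)
  next
    case False
    with \<open>0 \<le> a\<close> have "a > 0" by simp
    have *: "expectation (\<lambda>x. \<phi> (m + f x)) \<le> \<phi> q + a * (expectation (\<lambda>x. \<phi> (k + f x)) - k - oce \<phi> P f)" for k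
    proof -
      \<comment> \<open>With Z = \<open>Y x / a\<close>, the point \<open>k + f x\<close> bounds
        phi*(Z) from below and \<open>q\<close> bounds phi*(a). After integration the first leaves
        the objective at \<open>k\<close>, which is then chosen nearly optimal.\<close>
      have "\<phi> (m + f x) \<le> (m - k - q + \<phi> q / a) * Y x + a * \<phi> (k + f x)" for x
      proof -
        have "a * ((k + f x) * (Y x / a) - \<phi> (k + f x)) + Y x / a * (q * a - \<phi> q) \<le> (m + f x) * Y x - \<phi> (m + f x)"
          unfolding Y_def using Y0[of x] \<open>a > 0\<close>
          by (intro supermultiplicative_primal[OF H]) (auto simp: Y_def)
        moreover have "a * ((k + f x) * (Y x / a) - \<phi> (k + f x)) = (k + f x) * Y x - a * \<phi> (k + f x)"
          "Y x / a * (q * a - \<phi> q) = q * Y x - \<phi> q / a * Y x"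
          using \<open>a > 0\<close> by (simp_all add: right_diff_distrib)
        ultimately show ?thesis by (simp add: algebra_simps)
      qed
      then have "expectation (\<lambda>x. \<phi> (m + f x)) \<le> expectation (\<lambda>x. (m - k - q + \<phi> q / a) * Y x + a * \<phi> (k + f x))"
        by (intro integral_mono) auto
      also have "\<dots> = (m - k - q + \<phi> q / a) * a + a * expectation (\<lambda>x. \<phi> (k + f x))"
        by (simp add: a_def)
      also have "\<dots> = \<phi> q + a * (expectation (\<lambda>x. \<phi> (k + f x)) - k - oce \<phi> P f)"
        using \<open>a > 0\<close> by (simp add: field_simps q_def)
      finally show ?thesis .
    qed
    show ?thesis
    proof (rule field_le_epsilon)
      fix e :: real assume "e > 0"
      then have "e / a > 0" using \<open>a > 0\<close> by simp
      then obtain k where k: "expectation (\<lambda>x. \<phi> (k + f x)) - k < oce \<phi> P f + e / a" by (rule near_oce)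
      then have "a * (expectation (\<lambda>x. \<phi> (k + f x)) - k - oce \<phi> P f) \<le> a * (e / a)"
        using \<open>a > 0\<close> by (intro mult_left_mono) auto
      then show "expectation (\<lambda>x. \<phi> (m + f x)) \<le> \<phi> (m + oce \<phi> P f) + e"
        using *[of k] \<open>a > 0\<close> by (simp add: q_def)
    qed
  qed
qed

text \<open>A subgradient at \<open>k\<close> of the convex function k \<mapsto> E phi(k + f); where
  it equals 1, the objective defining the certainty equivalent is minimal.\<close>

definition D :: "real \<Rightarrow> real" where
  "D k = expectation (\<lambda>x. slope (k + f x))"

lemma D_mono: "k \<le> l \<Longrightarrow> D k \<le> D l"
  unfolding D_def by (intro integral_mono monoD[OF slope_mono]) auto

lemma D_bounds: "slope (k - C) \<le> D k" "D k \<le> slope (k + C)"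
proof -
  have "expectation (\<lambda>x. slope (k - C)) \<le> D k"
    unfolding D_def using f_bound
    by (intro integral_mono monoD[OF slope_mono]) (fastforce simp: abs_le_iff)+
  moreover have "D k \<le> expectation (\<lambda>x. slope (k + C))"
    unfolding D_def using f_bound
    by (intro integral_mono monoD[OF slope_mono]) (fastforce simp: abs_le_iff)+
  ultimately show "slope (k - C) \<le> D k" "D k \<le> slope (k + C)" by (auto simp: prob_space)
qed

text \<open>Since \<open>f\<close> is bounded by \<open>C\<close>, all slopes of phi then lie on the
  same side of 1, so phi(y) - y is monotone and approaches its infimum 0 at one end of the line.
  Shifting \<open>f\<close> by \<open>x + C\<close> or \<open>x - C\<close> puts all its values
  beyond a point \<open>x\<close> where this gap is already below \<open>e\<close>.\<close>

lemma oce_le_expectation: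
  assumes "(\<forall>k. D k < 1) \<or> (\<forall>k. D k > 1)"
  shows "oce \<phi> P f \<le> expectation f"
proof (rule field_le_epsilon)
  fix e :: real assume "e > 0"
  then obtain x where x: "\<phi> x < x + e" by (rule near_self)
  obtain k where k: "\<And>t. t \<in> space P \<Longrightarrow> \<phi> (k + f t) \<le> k + f t + e"
    using assms
  proof (elim disjE)
    assume "\<forall>k. D k < 1"
    then have s: "slope y < 1" for y
      using D_bounds(1)[of "y + C"] by (auto intro: le_less_trans)
    show ?thesis
    proof (rule that[of "x + C"])
      fix t assume "t \<in> space P"
      then have "x \<le> x + C + f t" using f_bound[of t] by (simp add: abs_le_iff)
      then have "slope (x + C + f t) * (x + C + f t - x) \<le> 1 * (x + C + f t - x)"
        using s by (intro mult_right_mono) (auto intro: less_imp_le)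
      then show "\<phi> (x + C + f t) \<le> x + C + f t + e"
        using above_tangent[of "x + C + f t" x] x by (simp add: algebra_simps)
    qed
  next
    assume "\<forall>k. D k > 1"
    then have s: "1 < slope y" for y
      using D_bounds(2)[of "y - C"] by (auto intro: less_le_trans)
    show ?thesis
    proof (rule that[of "x - C"])
      fix t assume "t \<in> space P"
      then have "x - C + f t \<le> x" using f_bound[of t] by (simp add: abs_le_iff)
      then have "1 * (x - (x - C + f t)) \<le> slope (x - C + f t) * (x - (x - C + f t))"
        using s by (intro mult_right_mono) (auto intro: less_imp_le)
      then show "\<phi> (x - C + f t) \<le> x - C + f t + e"
        using above_tangent[of "x - C + f t" x] x by (simp add: algebra_simps)
    qed
  qed
  have "expectation (\<lambda>t. \<phi> (k + f t)) \<le> expectation (\<lambda>t. k + f t + e)"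
    using k by (intro integral_mono) auto
  then show "oce \<phi> P f \<le> expectation f + e"
    using oce_le[of k] by (simp add: prob_space)
qed

text \<open>\<open>D\<close> is monotone but may jump over 1, so only two nearby points on either
  side can be expected. They are taken around the supremum of the set where \<open>D\<close> is at
  most 1.\<close>

lemma D_crossing:
  assumes "D k \<le> 1" "1 \<le> D l" "\<epsilon> > 0"
  obtains k1 k2 where "k1 \<le> k2" "k2 \<le> k1 + \<epsilon>" "D k1 \<le> 1" "1 \<le> D k2"
proof (cases "\<exists>k. D k = 1")
  case True
  then show ?thesis using that assms(3) by (metis less_eq_real_def le_add_same_cancel1)
next
  case False
  define S where "S = {k. D k \<le> 1}"
  have "k \<in> S" using assms by (simp add: S_def)
  have bdd: "bdd_above S"
  proof (rule bdd_aboveI)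
    fix x assume "x \<in> S"
    show "x \<le> l"
    proof (rule ccontr)
      assume "\<not> x \<le> l"
      then have "D l \<le> D x" by (intro D_mono) simp
      \<comment> \<open>The value 1 is excluded here, so \<open>1 \<le> D l\<close> is strict and
        contradicts \<open>D x \<le> 1\<close>.\<close>
      with \<open>x \<in> S\<close> assms False show False unfolding S_def by (metis mem_Collect_eq order_antisym order_trans)
    qed
  qed
  have "Sup S - \<epsilon> / 2 < Sup S" using assms by simp
  then obtain k1 where k1: "k1 \<in> S" "Sup S - \<epsilon> / 2 < k1"
    using less_cSup_iff[OF _ bdd] \<open>k \<in> S\<close> by blast
  have "k1 \<le> Sup S" by (rule cSup_upper[OF k1(1) bdd])
  have "Sup S + \<epsilon> / 2 \<notin> S"
    using cSup_upper[OF _ bdd, of "Sup S + \<epsilon> / 2"] assms by auto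
  then have "1 \<le> D (Sup S + \<epsilon> / 2)" by (simp add: S_def)
  then show ?thesis
    using k1 \<open>k1 \<le> Sup S\<close> assms by (intro that[of k1 "Sup S + \<epsilon> / 2"]) (auto simp: S_def)
qed

text \<open>Here \<open>W\<close> stands for an integrable majorant of \<open>\<phi>\<^sup>* (Z)\<close>. A slope of \<open>\<phi>\<close> along \<open>k + f\<close> with
  mean 1 would be an optimal density \<open>Z\<close>; when the mean slope jumps over 1, a convex combination of
  slopes at two nearby points is used, and when it stays on one side of 1, the density 1 is optimal.\<close>
lemma near_optimal_density:
  assumes "\<epsilon> > 0"
  obtains Z W :: "'e \<Rightarrow> real" where
    "integrable P Z" "integrable P W" "integrable P (\<lambda>x. Z x * f x)"
    "\<And>x. 0 \<le> Z x" "expectation Z = 1" "\<And>x p. p * Z x - \<phi> p \<le> W x"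
    "oce \<phi> P f - \<epsilon> \<le> expectation (\<lambda>x. Z x * f x) - expectation W"
proof (cases "(\<exists>k. D k \<le> 1) \<and> (\<exists>k. 1 \<le> D k)")
  case False
  then have "oce \<phi> P f \<le> expectation f"
    by (intro oce_le_expectation) (auto simp: not_le)
  then show ?thesis
    \<comment> \<open>The majorant 0 for the density 1 is phi*(1).\<close>
    using assms ge_self by (intro that[of "\<lambda>_. 1" "\<lambda>_. 0"]) (auto simp: prob_space)
next
  case True
  then obtain k1 k2 where k: "k1 \<le> k2" "k2 \<le> k1 + \<epsilon>" "D k1 \<le> 1" "1 \<le> D k2"
    using D_crossing assms by metis
  obtain l where l: "0 \<le> l" "l \<le> 1" "l * D k1 + (1 - l) * D k2 = 1"
  proof (cases "D k1 = D k2")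
    case True
    with k show ?thesis by (intro that[of 1]) auto
  next
    case False
    with k show ?thesis
      by (intro that[of "(D k2 - 1) / (D k2 - D k1)"]) (auto simp: divide_simps, simp_all add: algebra_simps)
  qed
  define Z where "Z x = l * slope (k1 + f x) + (1 - l) * slope (k2 + f x)" for x
  \<comment> \<open>By the equality case of Young's inequality, \<open>V k x\<close> is phi* at
    \<open>slope (k + f x)\<close>; convexity of phi* makes the convex combination \<open>W\<close>
    a majorant of phi*(Z).\<close>
  define V where "V k x = (k + f x) * slope (k + f x) - \<phi> (k + f x)" for k x
  define W where "W x = l * V k1 x + (1 - l) * V k2 x" for x
  have V [simp]: "integrable P (V k)" for k
  proof -
    have "V k = (\<lambda>x. k * slope (k + f x) + slope (k + f x) * f x - \<phi> (k + f x))"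
      by (simp add: V_def fun_eq_iff algebra_simps)
    then show ?thesis by simp
  qed
  have EV: "expectation (\<lambda>x. slope (k + f x) * f x) - expectation (V k)
      = expectation (\<lambda>x. \<phi> (k + f x)) - k * D k" for k
  proof -
    have "V k = (\<lambda>x. k * slope (k + f x) + slope (k + f x) * f x - \<phi> (k + f x))"
      by (simp add: V_def fun_eq_iff algebra_simps)
    then show ?thesis by (simp add: D_def)
  qed
  have Zf: "(\<lambda>x. Z x * f x) = (\<lambda>x. l * (slope (k1 + f x) * f x) + (1 - l) * (slope (k2 + f x) * f x))"
    by (simp add: Z_def fun_eq_iff algebra_simps)
  show ?thesis
  proof (rule that[of Z W])
    show "integrable P Z" "integrable P W" unfolding Z_def W_def by simp_all
    show "integrable P (\<lambda>x. Z x * f x)" unfolding Zf by simp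
    show "0 \<le> Z x" for x using l by (simp add: Z_def slope_nonneg)
    show "expectation Z = 1" using l by (simp add: Z_def[abs_def] D_def)
    show "p * Z x - \<phi> p \<le> W x" for p x
    proof -
      have V: "p * slope (k + f x) - \<phi> p \<le> V k x" for k
        using above_tangent[of "k + f x" p] by (simp add: V_def algebra_simps)
      have "p * Z x - \<phi> p = l * (p * slope (k1 + f x) - \<phi> p) + (1 - l) * (p * slope (k2 + f x) - \<phi> p)"
        by (simp add: Z_def algebra_simps)
      also have "\<dots> \<le> W x" unfolding W_def
        using l V by (intro add_mono mult_left_mono) auto
      finally show ?thesis .
    qed
    have "expectation (\<lambda>x. Z x * f x) - expectation W
        = l * (expectation (\<lambda>x. slope (k1 + f x) * f x) - expectation (V k1))
          + (1 - l) * (expectation (\<lambda>x. slope (k2 + f x) * f x) - expectation (V k2))"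
      unfolding Zf W_def[abs_def] by simp (simp add: algebra_simps)
    \<comment> \<open>The objectives at \<open>k1\<close> and \<open>k2\<close> are both at least
      the certainty equivalent. Mean slopes equal to 1 would cancel the terms in \<open>k1\<close>
      and \<open>k2\<close>; otherwise an error proportional to \<open>k2 - k1\<close> is
      left.\<close>
    also have "\<dots> \<ge> l * (oce \<phi> P f + k1 - k1 * D k1) + (1 - l) * (oce \<phi> P f + k2 - k2 * D k2)"
      unfolding EV using l oce_le[of k1] oce_le[of k2] by (intro add_mono mult_left_mono) auto
    also have "l * (oce \<phi> P f + k1 - k1 * D k1) + (1 - l) * (oce \<phi> P f + k2 - k2 * D k2)
        = oce \<phi> P f - (k2 - k1) * (l * (1 - D k1))"
    proof -
      have *: "(1 - l) * (1 - D k2) = - (l * (1 - D k1))" using l(3) by (simp add: algebra_simps)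
      have "l * (oce \<phi> P f + k1 - k1 * D k1) + (1 - l) * (oce \<phi> P f + k2 - k2 * D k2)
          = oce \<phi> P f + k1 * (l * (1 - D k1)) + k2 * ((1 - l) * (1 - D k2))" by (simp add: algebra_simps)
      then show ?thesis unfolding * by (simp add: algebra_simps)
    qed
    finally have "oce \<phi> P f - (k2 - k1) * (l * (1 - D k1))
        \<le> expectation (\<lambda>x. Z x * f x) - expectation W" .
    \<comment> \<open>Slopes are nonnegative, so \<open>1 - D k1\<close> lies in [0, 1] and the
      error is at most the gap \<open>k2 - k1\<close>.\<close>
    moreover have "(k2 - k1) * (l * (1 - D k1)) \<le> \<epsilon> * (1 * 1)"
      using k l D_bounds(1)[of k1] slope_nonneg[of "k1 - C"] by (intro mult_mono) auto
    ultimately show "oce \<phi> P f - \<epsilon> \<le> expectation (\<lambda>x. Z x * f x) - expectation W" by simp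
  qed
qed

lemma expectation_ge_of_submultiplicative:
  assumes H: "\<And>x y. 0 \<le> x \<Longrightarrow> 0 \<le> y \<Longrightarrow>
      conj_fun \<phi> (x * y) \<le> ereal y * conj_fun \<phi> x + ereal x * conj_fun \<phi> y"
  shows "\<phi> (m + oce \<phi> P f) \<le> expectation (\<lambda>x. \<phi> (m + f x))"
proof (rule field_le_epsilon)
  fix e :: real assume "e > 0"
  define c where "c = m + oce \<phi> P f"
  define a where "a = slope c"
  have "a \<ge> 0" by (simp add: a_def slope_nonneg)
  \<comment> \<open>The error of the near-optimal density is later multiplied by \<open>a\<close>;
    dividing by \<open>a + 1\<close> also covers \<open>a = 0\<close>.\<close>
  then have "e / (a + 1) > 0" using \<open>e > 0\<close> by simp
  then obtain Z W where ZW: "integrable P Z" "integrable P W" "integrable P (\<lambda>x. Z x * f x)"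
      "\<And>x. 0 \<le> Z x" "expectation Z = 1" "\<And>x p. p * Z x - \<phi> p \<le> W x"
      "oce \<phi> P f - e / (a + 1) \<le> expectation (\<lambda>x. Z x * f x) - expectation W"
    by (rule near_optimal_density) blast
  have "(m * a - (c * a - \<phi> c)) * Z x + a * (Z x * f x) - a * W x \<le> \<phi> (m + f x)" for x
    using submultiplicative_primal[OF H ZW(4,6), of "m + f x" x c] by (simp add: a_def algebra_simps)
  then have "expectation (\<lambda>x. (m * a - (c * a - \<phi> c)) * Z x + a * (Z x * f x) - a * W x)
      \<le> expectation (\<lambda>x. \<phi> (m + f x))"
    using ZW(1-3) by (intro integral_mono) auto
  also have "expectation (\<lambda>x. (m * a - (c * a - \<phi> c)) * Z x + a * (Z x * f x) - a * W x)
      = \<phi> c + a * (expectation (\<lambda>x. Z x * f x) - expectation W - oce \<phi> P f)"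
    using ZW(1-3,5) by (simp add: c_def algebra_simps)
  finally have *: "\<phi> c + a * (expectation (\<lambda>x. Z x * f x) - expectation W - oce \<phi> P f)
      \<le> expectation (\<lambda>x. \<phi> (m + f x))" .
  have "a * (- (e / (a + 1))) \<le> a * (expectation (\<lambda>x. Z x * f x) - expectation W - oce \<phi> P f)"
    using ZW(7) \<open>a \<ge> 0\<close> by (intro mult_left_mono) auto
  moreover have "a * (e / (a + 1)) \<le> e"
    using \<open>a \<ge> 0\<close> \<open>e > 0\<close> by (simp add: field_simps)
  ultimately show "\<phi> (m + oce \<phi> P f) \<le> expectation (\<lambda>x. \<phi> (m + f x)) + e"
    using * by (simp add: c_def)
qed

end

section \<open>Disintegrations\<close>

text \<open>\<open>Inf\<close> on the reals is defined through the \<open>LEAST\<close> upper bound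
  of the negated set, so it depends on the lower bounds alone, even where its value is junk.\<close>

lemma real_Inf_cong_lower_bounds:
  fixes A B :: "real set"
  assumes "\<And>b. (\<forall>x\<in>A. b \<le> x) \<longleftrightarrow> (\<forall>x\<in>B. b \<le> x)"
  shows "Inf A = Inf B"
proof -
  have "(\<forall>x\<in>uminus ` A. x \<le> z) \<longleftrightarrow> (\<forall>x\<in>uminus ` B. x \<le> z)" for z
    using assms[of "- z"] by (simp add: minus_le_iff)
  then show ?thesis unfolding Inf_real_def Sup_real_def by simp
qed

text \<open>Pushing \<open>L x\<close> forward along y \<mapsto> (x, y) makes the integrand
  independent of \<open>x\<close>, so that only the measure varies.\<close>

lemma integral_measurable_kernel:
  fixes f :: "'a \<Rightarrow> 'b \<Rightarrow> real"
  assumes [measurable]: "(\<lambda>(x, y). f x y) \<in> borel_measurable (M \<Otimes>\<^sub>M N)"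
    and L [measurable]: "L \<in> measurable M (subprob_algebra N)"
  shows "(\<lambda>x. \<integral>y. f x y \<partial>L x) \<in> borel_measurable M"
proof -
  note measurable_distr2 [measurable]
  have "(\<lambda>x. integral\<^sup>L (distr (L x) (M \<Otimes>\<^sub>M N) (\<lambda>y. (x, y))) (\<lambda>(x, y). f x y)) \<in> borel_measurable M"
    by measurable
  then show ?thesis
    by (rule measurable_cong[THEN iffD1, rotated]) (simp add: integral_distr)
qed

section \<open>Measurability of the certainty equivalent along a kernel\<close>

context oce_function
begin

lemma integrable_downward:
  assumes "finite_measure P" and [measurable]: "f \<in> borel_measurable P"
    and int: "integrable P (\<lambda>x. \<phi> (m + f x))" and "k \<le> m"
  shows "integrable P (\<lambda>x. \<phi> (k + f x))"
proof (rule Bochner_Integration.integrable_bound)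
  interpret finite_measure P by fact
  define d where "d = m - k"
  have "d \<ge> 0" using \<open>k \<le> m\<close> by (simp add: d_def)
  show "integrable P (\<lambda>x. \<bar>\<phi> (m + f x)\<bar> + (slope 0 * d + \<bar>\<phi> (- d)\<bar>))"
    using int by auto
  show "AE x in P. norm (\<phi> (k + f x)) \<le> norm (\<bar>\<phi> (m + f x)\<bar> + (slope 0 * d + \<bar>\<phi> (- d)\<bar>))"
  proof (rule AE_I2)
    fix x
    have up: "\<phi> (k + f x) \<le> \<phi> (m + f x)" using \<open>k \<le> m\<close> by (intro monoD[OF mono]) simp
    \<comment> \<open>Lowering the argument by \<open>d\<close> costs at most
      \<open>slope 0 * d\<close> if it starts at or below 0; if it starts above 0, it ends above
      \<open>- d\<close>.\<close>
    have "\<phi> (m + f x) - slope 0 * d \<le> \<phi> (k + f x) \<or> \<phi> (- d) \<le> \<phi> (k + f x)"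
    proof (cases "m + f x \<le> 0")
      case True
      then have "slope (m + f x) * d \<le> slope 0 * d"
        using \<open>d \<ge> 0\<close> by (intro mult_right_mono monoD[OF slope_mono])
      moreover have "k + f x - (m + f x) = - d" by (simp add: d_def)
      ultimately show ?thesis using above_tangent[of "m + f x" "k + f x"] by simp
    next
      case False
      then show ?thesis by (intro disjI2 monoD[OF mono]) (simp add: d_def)
    qed
    moreover have "0 \<le> slope 0 * d" using \<open>d \<ge> 0\<close> by (simp add: slope_nonneg)
    ultimately show "norm (\<phi> (k + f x)) \<le> norm (\<bar>\<phi> (m + f x)\<bar> + (slope 0 * d + \<bar>\<phi> (- d)\<bar>))"
      using up by (auto simp: abs_if)
  qed
qed simp

text \<open>No integrability is assumed: if \<open>\<phi> (m + f)\<close> is not integrable for some \<open>m\<close>, then it is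
  not integrable for any larger \<open>m\<close>, the Bochner integrals there are the junk value 0, and both
  infima are the junk infimum of a set that is unbounded below.\<close>
lemma oce_eq_Rats:
  assumes "prob_space P" and f [measurable]: "f \<in> borel_measurable P"
  shows "oce \<phi> P f = (INF m\<in>\<rat>. (\<integral>x. \<phi> (m + f x) \<partial>P) - m)"
proof -
  interpret prob_space P by fact
  define F where "F m = (\<integral>x. \<phi> (m + f x) \<partial>P) - m" for m
  have "b \<le> F m" if b: "\<And>m. m \<in> \<rat> \<Longrightarrow> b \<le> F m" for b m
  proof (cases "\<forall>m. integrable P (\<lambda>x. \<phi> (m + f x))")
    case True
    \<comment> \<open>A finite convex function on the line is continuous, so a lower bound on the
      rationals extends to all reals.\<close>
    have "convex_on UNIV (\<lambda>m. \<integral>x. \<phi> (m + f x) \<partial>P)"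
    proof (rule convex_onI)
      fix t k l :: real assume t: "0 < t" "t < 1"
      have "(\<integral>x. \<phi> ((1 - t) *\<^sub>R k + t *\<^sub>R l + f x) \<partial>P)
          \<le> (\<integral>x. (1 - t) * \<phi> (k + f x) + t * \<phi> (l + f x) \<partial>P)"
      proof (rule integral_mono)
        fix x
        have "(1 - t) *\<^sub>R k + t *\<^sub>R l + f x = (1 - t) *\<^sub>R (k + f x) + t *\<^sub>R (l + f x)"
          by (simp add: algebra_simps)
        then show "\<phi> ((1 - t) *\<^sub>R k + t *\<^sub>R l + f x) \<le> (1 - t) * \<phi> (k + f x) + t * \<phi> (l + f x)"
          using convex_onD[OF convex, of t "k + f x" "l + f x"] t by simp
      qed (use True in auto)
      then show "(\<integral>x. \<phi> ((1 - t) *\<^sub>R k + t *\<^sub>R l + f x) \<partial>P)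
          \<le> (1 - t) * (\<integral>x. \<phi> (k + f x) \<partial>P) + t * (\<integral>x. \<phi> (l + f x) \<partial>P)"
        using True by simp
    qed simp
    then have "continuous_on UNIV F"
      unfolding F_def by (intro continuous_intros convex_on_continuous) auto
    then show ?thesis
      using continuous_ge_on_closure[of \<rat> F m b] b by (simp add: Rats_closure_real)
  next
    case False
    then obtain m0 where m0: "\<not> integrable P (\<lambda>x. \<phi> (m0 + f x))" by blast
    \<comment> \<open>At a rational \<open>q\<close> beyond \<open>m0\<close> the integral is the
      default 0 and the objective is \<open>- q\<close>; taking \<open>q\<close> also beyond
      \<open>- b\<close> refutes the lower bound \<open>b\<close>.\<close>
    obtain q where q: "q \<in> \<rat>" "max m0 (- b) < q"
      using Rats_dense_in_real[of "max m0 (- b)" "max m0 (- b) + 1"] by auto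
    have "\<not> integrable P (\<lambda>x. \<phi> (q + f x))"
      using integrable_downward[OF finite_measure_axioms f, of q m0] m0 q by auto
    then have "F q < b" using q by (simp add: F_def not_integrable_integral_eq)
    with b[OF q(1)] show ?thesis by simp
  qed
  then have "Inf (range F) = Inf (F ` \<rat>)" by (intro real_Inf_cong_lower_bounds) auto
  then show ?thesis by (simp add: oce_def F_def)
qed

text \<open>The infimum over the rationals is countable. Unbounded integrands are allowed because
  \<open>cond_oce\<close> integrates the identity against laws that are concentrated on a bounded
  set only almost surely.\<close>

lemma oce_measurable:
  assumes [measurable]: "(\<lambda>(x, y). f x y) \<in> borel_measurable (M \<Otimes>\<^sub>M N)"
    and L [measurable]: "L \<in> measurable M (subprob_algebra N)"
    and prob: "\<And>x. x \<in> space M \<Longrightarrow> prob_space (L x)"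
  shows "(\<lambda>x. oce \<phi> (L x) (f x)) \<in> borel_measurable M"
proof -
  have "oce \<phi> (L x) (f x) = (INF m\<in>\<rat>. (\<integral>y. \<phi> (m + f x y) \<partial>L x) - m)" if "x \<in> space M" for x
    using that by (intro oce_eq_Rats prob) measurable
  moreover have "(\<lambda>x. INF m\<in>\<rat>. (\<integral>y. \<phi> (m + f x y) \<partial>L x) - m) \<in> borel_measurable M"
    by (intro borel_measurable_cINF_real countable_rat borel_measurable_diff
        integral_measurable_kernel[OF _ L] measurable_const) measurable
  ultimately show ?thesis by (simp cong: measurable_cong)
qed

end

text \<open>A common frame for both applications. For a product, \<open>P\<close> is
  \<open>mix \<mu> K\<close> and \<open>g\<close> a test function on it; for conditional laws,
  \<open>P\<close> is \<open>M\<close> itself, \<open>g\<close> is \<open>X\<close> and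
  \<open>L\<close> the regular conditional law. Disintegration is expressed by the integrals that
  enter the objective.\<close>

locale oce_disintegration = oce_function \<phi>
  for \<phi> :: "real \<Rightarrow> real" +
  fixes P :: "'p measure" and g :: "'p \<Rightarrow> real"
    and M :: "'a measure" and L :: "'a \<Rightarrow> 'b measure" and N :: "'b measure" and f :: "'a \<Rightarrow> 'b \<Rightarrow> real"
    and C :: real
  assumes P: "prob_space P" "g \<in> borel_measurable P" "\<And>z. z \<in> space P \<Longrightarrow> \<bar>g z\<bar> \<le> C"
    and M: "prob_space M"
    and L [measurable]: "L \<in> measurable M (subprob_algebra N)"
    and L_prob: "\<And>x. x \<in> space M \<Longrightarrow> prob_space (L x)"
    and f [measurable]: "(\<lambda>(x, y). f x y) \<in> borel_measurable (M \<Otimes>\<^sub>M N)"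
    and f_bound: "\<And>x y. x \<in> space M \<Longrightarrow> y \<in> space N \<Longrightarrow> \<bar>f x y\<bar> \<le> C"
    and disintegration: "\<And>m. (\<integral>z. \<phi> (m + g z) \<partial>P) = (\<integral>x. (\<integral>y. \<phi> (m + f x y) \<partial>L x) \<partial>M)"
begin

sublocale total: oce_function_prob \<phi> P g C
  using P by (intro oce_function_prob.intro oce_function_axioms oce_function_prob_axioms.intro)

lemma fiber: "x \<in> space M \<Longrightarrow> oce_function_prob \<phi> (L x) (f x) C"
  using L_prob f_bound sets_eq_imp_space_eq[OF sets_kernel[OF L]]
  by (intro oce_function_prob.intro oce_function_axioms oce_function_prob_axioms.intro)
    (auto, measurable)

definition cond :: "'a \<Rightarrow> real" where
  "cond x = oce \<phi> (L x) (f x)"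

sublocale base: oce_function_prob \<phi> M cond C
proof (intro oce_function_prob.intro oce_function_axioms oce_function_prob_axioms.intro M)
  show "cond \<in> borel_measurable M"
    unfolding cond_def by (rule oce_measurable[OF f L L_prob])
  show "\<bar>cond x\<bar> \<le> C" if "x \<in> space M" for x
    unfolding cond_def by (rule oce_function_prob.oce_bound[OF fiber[OF that]])
qed

lemma integrable_fiber: "integrable M (\<lambda>x. \<integral>y. \<phi> (m + f x y) \<partial>L x)"
proof (rule base.integrable_const_bound)
  show "(\<lambda>x. \<integral>y. \<phi> (m + f x y) \<partial>L x) \<in> borel_measurable M"
    by (rule integral_measurable_kernel[OF _ L]) measurable
  show "AE x in M. norm (\<integral>y. \<phi> (m + f x y) \<partial>L x) \<le> \<bar>\<phi> (m - C)\<bar> + \<bar>\<phi> (m + C)\<bar>"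
  proof (rule AE_I2)
    fix x assume "x \<in> space M"
    then interpret oce_function_prob \<phi> "L x" "f x" C by (rule fiber)
    have "norm (\<integral>y. \<phi> (m + f x y) \<partial>L x) \<le> (\<integral>y. norm (\<phi> (m + f x y)) \<partial>L x)" by simp
    also have "\<dots> \<le> (\<integral>y. \<bar>\<phi> (m - C)\<bar> + \<bar>\<phi> (m + C)\<bar> \<partial>L x)"
      using abs_bound[OF f_bound] by (intro integral_mono) auto
    finally show "norm (\<integral>y. \<phi> (m + f x y) \<partial>L x) \<le> \<bar>\<phi> (m - C)\<bar> + \<bar>\<phi> (m + C)\<bar>"
      by (simp add: prob_space)
  qed
qed

lemma oce_le_oce_cond:
  assumes H: "\<And>x y. 0 \<le> x \<Longrightarrow> 0 \<le> y \<Longrightarrow>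
      ereal y * conj_fun \<phi> x + ereal x * conj_fun \<phi> y \<le> conj_fun \<phi> (x * y)"
  shows "oce \<phi> P g \<le> oce \<phi> M cond"
proof (rule field_le_epsilon)
  fix e :: real assume "e > 0"
  then obtain m where m: "(\<integral>x. \<phi> (m + cond x) \<partial>M) - m < oce \<phi> M cond + e" by (rule base.near_oce)
  have "(\<integral>z. \<phi> (m + g z) \<partial>P) \<le> (\<integral>x. \<phi> (m + cond x) \<partial>M)"
    unfolding disintegration
    using oce_function_prob.expectation_le_of_supermultiplicative[OF fiber H]
    by (intro integral_mono integrable_fiber base.phi_integrable) (auto simp: cond_def)
  with m total.oce_le[of m] show "oce \<phi> P g \<le> oce \<phi> M cond + e" by simp
qed

lemma oce_cond_le_oce:
  assumes H: "\<And>x y. 0 \<le> x \<Longrightarrow> 0 \<le> y \<Longrightarrow>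
      conj_fun \<phi> (x * y) \<le> ereal y * conj_fun \<phi> x + ereal x * conj_fun \<phi> y"
  shows "oce \<phi> M cond \<le> oce \<phi> P g"
proof (rule field_le_epsilon)
  fix e :: real assume "e > 0"
  then obtain m where m: "(\<integral>z. \<phi> (m + g z) \<partial>P) - m < oce \<phi> P g + e" by (rule total.near_oce)
  have "(\<integral>x. \<phi> (m + cond x) \<partial>M) \<le> (\<integral>z. \<phi> (m + g z) \<partial>P)"
    unfolding disintegration
    using oce_function_prob.expectation_ge_of_submultiplicative[OF fiber H]
    by (intro integral_mono integrable_fiber base.phi_integrable) (auto simp: cond_def)
  with m base.oce_le[of m] show "oce \<phi> M cond \<le> oce \<phi> P g + e" by simp
qed

end

section \<open>Subadditivity\<close>

lemma prob_on_space: "prob_on \<mu> \<Longrightarrow> space \<mu> = UNIV"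
  using sets_eq_imp_space_eq[of \<mu> borel] by (simp add: prob_on_def)

lemma kernel_onD:
  assumes "kernel_on (K :: 'e::topological_space \<Rightarrow> 'f::topological_space measure)"
  shows "K \<in> borel \<rightarrow>\<^sub>M subprob_algebra borel" "prob_space (K x)" "sets (K x) = sets borel" "prob_on (K x)"
  using assms sets_kernel[of K borel "borel :: 'f measure" x] by (auto simp: kernel_on_def prob_on_def)

section \<open>Integration against mu(dx) K_x(dy)\<close>

context
  fixes \<mu> :: "'e::polish_space measure" and K :: "'e \<Rightarrow> 'f::polish_space measure"
  assumes \<mu>: "prob_on \<mu>" and K: "kernel_on K"
begin

private lemma sets_\<mu> [measurable_cong]: "sets \<mu> = sets borel"
  using \<mu> by (simp add: prob_on_def)

private lemma K_measurable [measurable]: "K \<in> \<mu> \<rightarrow>\<^sub>M subprob_algebra borel"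
  using kernel_onD(1)[OF K] by (simp cong: measurable_cong_sets add: sets_\<mu>)

text \<open>On second countable spaces the product sigma-algebra is the Borel one. Kernels produce
  the former, while \<open>mix\<close> lives on the latter.\<close>

private lemma pair_measurable: "(\<lambda>p. p) \<in> \<mu> \<Otimes>\<^sub>M (borel :: 'f measure) \<rightarrow>\<^sub>M (borel :: ('e \<times> 'f) measure)"
proof -
  have "sets (\<mu> \<Otimes>\<^sub>M (borel :: 'f measure)) = sets (borel :: ('e \<times> 'f) measure)"
    by (simp add: borel_prod[symmetric] sets_\<mu> cong: sets_pair_measure_cong)
  then show ?thesis by (rule measurable_ident_sets)
qed

private lemma inner_measurable:
  "(\<lambda>x. K x \<bind> (\<lambda>y. return (borel :: ('e \<times> 'f) measure) (x, y))) \<in> \<mu> \<rightarrow>\<^sub>M subprob_algebra borel"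
  by (rule measurable_bind[OF K_measurable])
    (simp add: measurable_compose[OF pair_measurable return_measurable])

private lemma return_pair_measurable:
  "(\<lambda>y. return (borel :: ('e \<times> 'f) measure) (x, y)) \<in> borel \<rightarrow>\<^sub>M subprob_algebra borel"
  by (rule measurable_compose[OF _ return_measurable]) (simp add: borel_measurable_Pair)

lemma prob_on_mix: "prob_on (mix \<mu> K)"
proof -
  interpret prob_space \<mu> using \<mu> by (simp add: prob_on_def)
  have inner: "prob_space (K x \<bind> (\<lambda>y. return (borel :: ('e \<times> 'f) measure) (x, y)))" for x
  proof -
    interpret K: prob_space "K x" by (rule kernel_onD(2)[OF K])
    show ?thesis
    proof (rule K.prob_space_bind)
      show "(\<lambda>y. return (borel :: ('e \<times> 'f) measure) (x, y)) \<in> K x \<rightarrow>\<^sub>M subprob_algebra borel"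
        using return_pair_measurable by (simp cong: measurable_cong_sets add: kernel_onD(3)[OF K])
    qed (auto intro!: AE_I2 prob_space_return)
  qed
  have "prob_space (mix \<mu> K)"
    unfolding mix_def by (rule prob_space_bind[OF _ inner_measurable]) (simp add: inner)
  moreover have "sets (mix \<mu> K) = sets borel"
    unfolding mix_def using sets_kernel[OF inner_measurable] not_empty by (rule sets_bind)
  ultimately show ?thesis by (simp add: prob_on_def)
qed

lemma integral_mix:
  fixes u :: "'e \<times> 'f \<Rightarrow> real"
  assumes u [measurable]: "u \<in> borel_measurable borel" and bound: "\<And>z. \<bar>u z\<bar> \<le> C"
  shows "(\<integral>z. u z \<partial>mix \<mu> K) = (\<integral>x. (\<integral>y. u (x, y) \<partial>K x) \<partial>\<mu>)"
proof -
  interpret prob_space \<mu> using \<mu> by (simp add: prob_on_def)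
  have sub: "emeasure M (space M) \<le> ennreal 1" if "subprob_space M" for M :: "'x measure"
    using subprob_space.emeasure_space_le_1[OF that] by simp
  have "(\<integral>z. u z \<partial>mix \<mu> K) = (\<integral>x. (\<integral>z. u z \<partial>(K x \<bind> (\<lambda>y. return borel (x, y)))) \<partial>\<mu>)"
    unfolding mix_def
    by (rule integral_bind[OF u bound inner_measurable finite_measure_axioms])
      (auto intro!: AE_I2 sub subprob_space_kernel[OF inner_measurable])
  also have "\<dots> = (\<integral>x. (\<integral>y. u (x, y) \<partial>K x) \<partial>\<mu>)"
  proof (rule Bochner_Integration.integral_cong[OF refl])
    fix x
    interpret K: prob_space "K x" by (rule kernel_onD(2)[OF K])
    have ret: "(\<lambda>y. return (borel :: ('e \<times> 'f) measure) (x, y)) \<in> K x \<rightarrow>\<^sub>M subprob_algebra borel"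
      using return_pair_measurable by (simp cong: measurable_cong_sets add: kernel_onD(3)[OF K])
    have "(\<integral>z. u z \<partial>(K x \<bind> (\<lambda>y. return borel (x, y)))) = (\<integral>y. (\<integral>z. u z \<partial>return borel (x, y)) \<partial>K x)"
      by (rule integral_bind[OF u bound ret K.finite_measure_axioms])
        (auto intro!: AE_I2 sub subprob_space_kernel[OF ret])
    also have "\<dots> = (\<integral>y. u (x, y) \<partial>K x)"
      by (simp add: integral_return)
    finally show "(\<integral>z. u z \<partial>(K x \<bind> (\<lambda>y. return borel (x, y)))) = (\<integral>y. u (x, y) \<partial>K x)" .
  qed
  finally show ?thesis .
qed

lemma oce_disintegration_mix:
  fixes u :: "'e \<times> 'f \<Rightarrow> real"
  assumes "oce_function \<phi>" and u [measurable]: "u \<in> borel_measurable borel" and bound: "\<And>z. \<bar>u z\<bar> \<le> C"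
  shows "oce_disintegration \<phi> (mix \<mu> K) u \<mu> K borel (\<lambda>x y. u (x, y)) C"
proof -
  interpret oce_function \<phi> by fact
  have mix: "prob_space (mix \<mu> K)" "sets (mix \<mu> K) = sets borel"
    using prob_on_mix by (auto simp: prob_on_def)
  show ?thesis
  proof (intro oce_disintegration.intro oce_function_axioms oce_disintegration_axioms.intro)
    show "u \<in> borel_measurable (mix \<mu> K)"
      using u by (simp cong: measurable_cong_sets add: mix(2))
    show "(\<lambda>(x, y). u (x, y)) \<in> borel_measurable (\<mu> \<Otimes>\<^sub>M borel)"
      using measurable_compose[OF pair_measurable u] by simp
    show "(\<integral>z. \<phi> (m + u z) \<partial>mix \<mu> K) = (\<integral>x. (\<integral>y. \<phi> (m + u (x, y)) \<partial>K x) \<partial>\<mu>)" for m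
      by (rule integral_mix[OF _ abs_bound[OF bound]]) simp
    show "prob_space \<mu>" using \<mu> by (simp add: prob_on_def)
  qed (simp_all add: mix(1) bound K_measurable kernel_onD(2)[OF K])
qed

end

lemma ind_div_upper:
  assumes "f \<in> borel_measurable borel" "\<And>x. \<bar>f x\<bar> \<le> C"
  shows "ereal ((\<integral>x. f x \<partial>\<nu>) - oce \<phi> \<mu> f) \<le> ind_div \<phi> \<nu> \<mu>"
proof -
  have "bounded (range f)" by (rule boundedI[of _ C]) (use assms(2) in auto)
  with assms(1) show ?thesis unfolding ind_div_def by (intro SUP_upper) simp
qed

text \<open>\<open>ennreal\<close> cuts off the negative part, hence an inequality. It leads from
  differences of test values, which may be negative, to the nonnegative integral of the
  divergence.\<close>

lemma (in finite_measure) integral_le_nn_integral: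
  assumes [measurable]: "d \<in> borel_measurable M" and bound: "\<And>x. x \<in> space M \<Longrightarrow> \<bar>d x\<bar> \<le> C"
  shows "ereal (\<integral>x. d x \<partial>M) \<le> enn2ereal (\<integral>\<^sup>+ x. ennreal (d x) \<partial>M)"
proof -
  have int: "integrable M d"
    by (rule integrable_const_bound[where B = C]) (simp_all add: AE_I2 bound)
  then have int0: "integrable M (\<lambda>x. max 0 (d x))" by simp
  have "(\<integral>x. d x \<partial>M) \<le> (\<integral>x. max 0 (d x) \<partial>M)"
    by (rule integral_mono[OF int int0]) simp
  moreover have "(\<integral>\<^sup>+ x. ennreal (d x) \<partial>M) = (\<integral>\<^sup>+ x. ennreal (max 0 (d x)) \<partial>M)"
    by (intro nn_integral_cong) (auto simp: max_def ennreal_neg)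
  moreover have "(\<integral>\<^sup>+ x. ennreal (max 0 (d x)) \<partial>M) = ennreal (\<integral>x. max 0 (d x) \<partial>M)"
    by (intro nn_integral_eq_integral int0) simp
  moreover have "0 \<le> (\<integral>x. max 0 (d x) \<partial>M)" by simp
  ultimately show ?thesis by (simp add: enn2ereal_ennreal)
qed

lemma (in oce_function) div_subadditiveI:
  assumes H: "\<And>x y. 0 \<le> x \<Longrightarrow> 0 \<le> y \<Longrightarrow>
      conj_fun \<phi> (x * y) \<le> ereal y * conj_fun \<phi> x + ereal x * conj_fun \<phi> y"
  shows "div_subadditive \<phi> TYPE('e::polish_space) TYPE('f::polish_space)"
  unfolding div_subadditive_def
proof (intro allI impI)
  fix \<mu> \<nu> :: "'e measure" and K\<mu> K\<nu> :: "'e \<Rightarrow> 'f measure"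
  assume \<mu>: "prob_on \<mu>" and \<nu>: "prob_on \<nu>" and K\<mu>: "kernel_on K\<mu>" and K\<nu>: "kernel_on K\<nu>"
  show "ind_div \<phi> (mix \<nu> K\<nu>) (mix \<mu> K\<mu>)
      \<le> ind_div \<phi> \<nu> \<mu> + enn2ereal (\<integral>\<^sup>+ x. e2ennreal (ind_div \<phi> (K\<nu> x) (K\<mu> x)) \<partial>\<nu>)"
    unfolding ind_div_def[of \<phi> "mix \<nu> K\<nu>"]
  proof (rule SUP_least)
    fix u :: "'e \<times> 'f \<Rightarrow> real"
    assume "u \<in> {u. u \<in> borel_measurable borel \<and> bounded (range u)}"
    then obtain C where u [measurable]: "u \<in> borel_measurable borel" and bound: "\<And>z. \<bar>u z\<bar> \<le> C"
      by (auto simp: bounded_iff)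
    interpret \<mu>: oce_disintegration \<phi> "mix \<mu> K\<mu>" u \<mu> K\<mu> borel "\<lambda>x y. u (x, y)" C
      by (rule oce_disintegration_mix[OF \<mu> K\<mu> oce_function_axioms u bound])
    interpret \<nu>: prob_space \<nu> using \<nu> by (simp add: prob_on_def)
    have sets_\<nu> [measurable_cong]: "sets \<nu> = sets borel" using \<nu> by (simp add: prob_on_def)
    have sets_\<mu> [measurable_cong]: "sets \<mu> = sets borel" using \<mu> by (simp add: prob_on_def)
    have K\<nu>_measurable: "K\<nu> \<in> \<nu> \<rightarrow>\<^sub>M subprob_algebra borel"
      using kernel_onD(1)[OF K\<nu>] by (simp cong: measurable_cong_sets add: sets_\<nu>)
    define i where "i x = (\<integral>y. u (x, y) \<partial>K\<nu> x)" for x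
    have u_pair: "(\<lambda>(x, y). u (x, y)) \<in> borel_measurable (\<nu> \<Otimes>\<^sub>M borel)"
      using \<mu>.f by (simp cong: measurable_cong_sets sets_pair_measure_cong add: sets_\<nu> sets_\<mu>)
    have i [measurable]: "i \<in> borel_measurable \<nu>"
      unfolding i_def by (rule integral_measurable_kernel[OF u_pair K\<nu>_measurable])
    have c [measurable]: "\<mu>.cond \<in> borel_measurable borel"
      using \<mu>.base.f_measurable by (simp cong: measurable_cong_sets add: sets_\<mu>)
    have i_bound: "\<bar>i x\<bar> \<le> C" for x
    proof -
      interpret K: prob_space "K\<nu> x" by (rule kernel_onD(2)[OF K\<nu>])
      have [measurable]: "(\<lambda>y. u (x, y)) \<in> borel_measurable (K\<nu> x)"
        by (simp cong: measurable_cong_sets add: kernel_onD(3)[OF K\<nu>])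
      have "norm (i x) \<le> (\<integral>y. norm (u (x, y)) \<partial>K\<nu> x)" unfolding i_def by simp
      also have "\<dots> \<le> (\<integral>y. C \<partial>K\<nu> x)"
      proof (rule integral_mono)
        show "integrable (K\<nu> x) (\<lambda>y. norm (u (x, y)))"
          using bound by (intro K.integrable_const_bound[where B = C]) auto
      qed (use bound in auto)
      finally show ?thesis by (simp add: K.prob_space)
    qed
    have c_bound: "\<bar>\<mu>.cond x\<bar> \<le> C" for x
      using \<mu>.base.f_bound[of x] prob_on_space[OF \<mu>] by simp
    have int: "integrable \<nu> i" "integrable \<nu> \<mu>.cond"
      using i_bound c_bound by (auto intro!: \<nu>.integrable_const_bound[where B = C])
    \<comment> \<open>The first bracket is the value of \<open>\<mu>.cond\<close> as a test function
      for alpha(nu|mu); the integrand \<open>i x - \<mu>.cond x\<close> is the value of u(x, .) as a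
      test function for the divergence of the kernels at \<open>x\<close>.\<close>
    have "(\<integral>z. u z \<partial>mix \<nu> K\<nu>) - oce \<phi> (mix \<mu> K\<mu>) u
        \<le> ((\<integral>x. \<mu>.cond x \<partial>\<nu>) - oce \<phi> \<mu> \<mu>.cond) + (\<integral>x. i x - \<mu>.cond x \<partial>\<nu>)"
      using \<mu>.oce_cond_le_oce[OF H]
      by (simp add: integral_mix[OF \<nu> K\<nu> u bound] i_def[symmetric] Bochner_Integration.integral_diff[OF int])
    then have "ereal ((\<integral>z. u z \<partial>mix \<nu> K\<nu>) - oce \<phi> (mix \<mu> K\<mu>) u)
        \<le> ereal ((\<integral>x. \<mu>.cond x \<partial>\<nu>) - oce \<phi> \<mu> \<mu>.cond) + ereal (\<integral>x. i x - \<mu>.cond x \<partial>\<nu>)"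
      by simp
    also have "\<dots> \<le> ind_div \<phi> \<nu> \<mu> + enn2ereal (\<integral>\<^sup>+ x. ennreal (i x - \<mu>.cond x) \<partial>\<nu>)"
    proof (rule add_mono[OF ind_div_upper[OF c c_bound] \<nu>.integral_le_nn_integral])
      show "\<bar>i x - \<mu>.cond x\<bar> \<le> C + C" for x
        using i_bound[of x] c_bound[of x] by linarith
    qed measurable
    also have "\<dots> \<le> ind_div \<phi> \<nu> \<mu> + enn2ereal (\<integral>\<^sup>+ x. e2ennreal (ind_div \<phi> (K\<nu> x) (K\<mu> x)) \<partial>\<nu>)"
    proof (intro add_left_mono)
      have "ennreal (i x - \<mu>.cond x) \<le> e2ennreal (ind_div \<phi> (K\<nu> x) (K\<mu> x))" for x
        using e2ennreal_mono[OF ind_div_upper[of "\<lambda>y. u (x, y)" C "K\<nu> x" \<phi> "K\<mu> x"]] bound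
        by (simp add: e2ennreal_ereal i_def \<mu>.cond_def)
      then show "enn2ereal (\<integral>\<^sup>+ x. ennreal (i x - \<mu>.cond x) \<partial>\<nu>)
          \<le> enn2ereal (\<integral>\<^sup>+ x. e2ennreal (ind_div \<phi> (K\<nu> x) (K\<mu> x)) \<partial>\<nu>)"
        by (simp add: less_eq_ennreal.rep_eq[symmetric] nn_integral_mono)
    qed
    finally show "ereal ((\<integral>z. u z \<partial>mix \<nu> K\<nu>) - oce \<phi> (mix \<mu> K\<mu>) u)
      \<le> ind_div \<phi> \<nu> \<mu> + enn2ereal (\<integral>\<^sup>+ x. e2ennreal (ind_div \<phi> (K\<nu> x) (K\<mu> x)) \<partial>\<nu>)" .
  qed
qed

section \<open>Consistency for regular conditional laws\<close>

lemma reg_cond_law_kernel: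
  assumes "prob_space M" and G: "subalgebra M G" and K: "reg_cond_law M G X K"
  shows "K \<in> M \<rightarrow>\<^sub>M subprob_algebra borel"
proof (rule measurable_subprob_algebra)
  fix \<omega> assume \<omega>: "\<omega> \<in> space M"
  then interpret prob_space "K \<omega>" using K by (simp add: reg_cond_law_def)
  show "subprob_space (K \<omega>)" by unfold_locales
  show "sets (K \<omega>) = sets borel" using K \<omega> by (simp add: reg_cond_law_def)
next
  fix B :: "real set" assume "B \<in> sets borel"
  then have "(\<lambda>\<omega>. measure (K \<omega>) B) \<in> borel_measurable G" using K by (simp add: reg_cond_law_def)
  then have "(\<lambda>\<omega>. measure (K \<omega>) B) \<in> borel_measurable M"
    by (rule measurable_from_subalg[OF G])
  then have "(\<lambda>\<omega>. ennreal (measure (K \<omega>) B)) \<in> borel_measurable M" by measurable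
  moreover have "emeasure (K \<omega>) B = ennreal (measure (K \<omega>) B)" if "\<omega> \<in> space M" for \<omega>
  proof -
    interpret prob_space "K \<omega>" using K that by (simp add: reg_cond_law_def)
    show ?thesis by (rule emeasure_eq_measure)
  qed
  ultimately show "(\<lambda>\<omega>. emeasure (K \<omega>) B) \<in> borel_measurable M"
    by (simp cong: measurable_cong)
qed

text \<open>The defining identity of a conditional law, taken with the whole space as conditioning
  event.\<close>

lemma reg_cond_law_bind:
  assumes "prob_space M" and G: "subalgebra M G" and K: "reg_cond_law M G X K"
    and X: "X \<in> borel_measurable M"
  shows "M \<bind> K = distr M borel X"
proof (rule measure_eqI)
  interpret prob_space M by fact
  note K_measurable = reg_cond_law_kernel[OF assms(1-3)]
  show sets: "sets (M \<bind> K) = sets (distr M borel X)"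
    using sets_bind[OF sets_kernel[OF K_measurable] not_empty] by simp
  fix B assume "B \<in> sets (M \<bind> K)"
  then have B: "B \<in> sets borel" using sets by simp
  have prob: "prob_space (K \<omega>)" if "\<omega> \<in> space M" for \<omega>
    using K that by (simp add: reg_cond_law_def)
  have "(\<lambda>\<omega>. measure (K \<omega>) B) \<in> borel_measurable G" using K B by (simp add: reg_cond_law_def)
  then have [measurable]: "(\<lambda>\<omega>. measure (K \<omega>) B) \<in> borel_measurable M"
    by (rule measurable_from_subalg[OF G])
  have "emeasure (M \<bind> K) B = (\<integral>\<^sup>+ \<omega>. emeasure (K \<omega>) B \<partial>M)"
    by (rule emeasure_bind[OF not_empty K_measurable B])
  also have "\<dots> = (\<integral>\<^sup>+ \<omega>. ennreal (measure (K \<omega>) B) \<partial>M)"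
    by (intro nn_integral_cong finite_measure.emeasure_eq_measure prob_space.finite_measure prob)
  also have "\<dots> = ennreal (\<integral>\<omega>. measure (K \<omega>) B \<partial>M)"
    by (intro nn_integral_eq_integral integrable_const_bound[where B = 1] AE_I2)
      (auto simp: prob_space.prob_le_1[OF prob])
  also have "(\<integral>\<omega>. measure (K \<omega>) B \<partial>M) = (\<integral>\<omega>. indicator (space M) \<omega> * measure (K \<omega>) B \<partial>M)"
    by (intro Bochner_Integration.integral_cong) auto
  also have "\<dots> = measure M (space M \<inter> X -` B \<inter> space M)"
    using K B sets.top[of G] G unfolding reg_cond_law_def subalgebra_def by auto
  also have "ennreal \<dots> = emeasure (distr M borel X) B"
    using X B by (simp add: emeasure_distr emeasure_eq_measure Int_commute)
  finally show "emeasure (M \<bind> K) B = emeasure (distr M borel X) B" .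
qed

text \<open>On a null set the conditional law may charge points outside [-C, C], so the identity is
  not uniformly bounded on the fibres. Clamping it restores the bound everywhere and agrees with the
  identity on the values of \<open>X\<close>.\<close>

lemma oce_disintegration_reg_cond_law:
  assumes \<phi>: "oce_function \<phi>" and M: "prob_space M" and G: "subalgebra M G" and K: "reg_cond_law M G X K"
    and X: "X \<in> borel_measurable M" and bound: "\<And>\<omega>. \<omega> \<in> space M \<Longrightarrow> \<bar>X \<omega>\<bar> \<le> C" and "0 \<le> C"
  shows "oce_disintegration \<phi> M X M K borel (\<lambda>\<omega> x. max (- C) (min C x)) C"
proof -
  interpret oce_function \<phi> by fact
  interpret prob_space M by fact
  note K_measurable = reg_cond_law_kernel[OF M G K]
  show ?thesis
  proof (intro oce_disintegration.intro oce_function_axioms oce_disintegration_axioms.intro M X K_measurable bound)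
    show "prob_space (K \<omega>)" if "\<omega> \<in> space M" for \<omega>
      using K that by (simp add: reg_cond_law_def)
    show "(\<lambda>(\<omega>, x). max (- C) (min C x)) \<in> borel_measurable (M \<Otimes>\<^sub>M borel)" by measurable
    show clamp: "\<bar>max (- C) (min C x)\<bar> \<le> C" for x using \<open>0 \<le> C\<close> by auto
    show "(\<integral>\<omega>. \<phi> (m + X \<omega>) \<partial>M) = (\<integral>\<omega>. (\<integral>x. \<phi> (m + max (- C) (min C x)) \<partial>K \<omega>) \<partial>M)" for m
    proof -
      have "(\<integral>\<omega>. \<phi> (m + X \<omega>) \<partial>M) = (\<integral>\<omega>. \<phi> (m + max (- C) (min C (X \<omega>))) \<partial>M)"
      proof (rule Bochner_Integration.integral_cong[OF refl])
        fix \<omega> assume "\<omega> \<in> space M"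
        then show "\<phi> (m + X \<omega>) = \<phi> (m + max (- C) (min C (X \<omega>)))"
          using bound[of \<omega>] by (simp add: abs_le_iff min_absorb2 max_absorb2)
      qed
      also have "\<dots> = (\<integral>x. \<phi> (m + max (- C) (min C x)) \<partial>(M \<bind> K))"
        by (simp add: reg_cond_law_bind[OF M G K X] integral_distr[OF X])
      also have "\<dots> = (\<integral>\<omega>. (\<integral>x. \<phi> (m + max (- C) (min C x)) \<partial>K \<omega>) \<partial>M)"
        by (rule integral_bind[OF _ abs_bound[OF clamp] K_measurable finite_measure_axioms, where B' = 1])
          (auto intro!: AE_I2 subprob_space.emeasure_space_le_1 subprob_space_kernel[OF K_measurable])
      finally show ?thesis .
    qed
  qed
qed

lemma oce_cong_AE:
  assumes "oce_function \<phi>" and "f \<in> borel_measurable P" "g \<in> borel_measurable P" and "AE x in P. f x = g x"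
  shows "oce \<phi> P f = oce \<phi> P g"
proof -
  interpret oce_function \<phi> by fact
  have "(\<integral>x. \<phi> (m + f x) \<partial>P) = (\<integral>x. \<phi> (m + g x) \<partial>P)" for m
    using assms(2-4) by (intro integral_cong_AE) auto
  then show ?thesis by (simp add: oce_def)
qed

text \<open>The mixture of the conditional laws is the law of \<open>X\<close>, which lives on
  [-C, C]. Almost every conditional law therefore does so too, and there clamping changes
  nothing.\<close>

lemma oce_cond_oce_eq:
  assumes \<phi>: "oce_function \<phi>" and M: "prob_space M" and G: "subalgebra M G" and K: "reg_cond_law M G X K"
    and X: "X \<in> borel_measurable M" and bound: "\<And>\<omega>. \<omega> \<in> space M \<Longrightarrow> \<bar>X \<omega>\<bar> \<le> C" and "0 \<le> C"
  shows "oce \<phi> M (cond_oce \<phi> K) = oce \<phi> M (\<lambda>\<omega>. oce \<phi> (K \<omega>) (\<lambda>x. max (- C) (min C x)))"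
proof -
  interpret oce_function \<phi> by fact
  note K_measurable = reg_cond_law_kernel[OF M G K]
  have prob: "prob_space (K \<omega>)" if "\<omega> \<in> space M" for \<omega>
    using K that by (simp add: reg_cond_law_def)
  have "AE x in distr M borel X. \<bar>x\<bar> \<le> C"
    using bound X by (subst AE_distr_iff) auto
  then have "AE \<omega> in M. AE x in K \<omega>. \<bar>x\<bar> \<le> C"
    unfolding reg_cond_law_bind[OF M G K X, symmetric]
    by (subst (asm) AE_bind[OF K_measurable]) measurable
  with AE_space have ae: "AE \<omega> in M. cond_oce \<phi> K \<omega> = oce \<phi> (K \<omega>) (\<lambda>x. max (- C) (min C x))"
  proof eventually_elim
    case (elim \<omega>)
    then have sets: "sets (K \<omega>) = sets borel" using K by (simp add: reg_cond_law_def)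
    have "AE x in K \<omega>. x = max (- C) (min C x)"
      using elim(2) by eventually_elim (simp add: abs_le_iff min_absorb2 max_absorb2)
    then show ?case unfolding cond_oce_def
      by (intro oce_cong_AE[OF \<phi>]) (simp_all cong: measurable_cong_sets add: sets)
  qed
  show ?thesis
  proof (rule oce_cong_AE[OF \<phi> _ _ ae])
    show "cond_oce \<phi> K \<in> borel_measurable M"
      unfolding cond_oce_def[abs_def] by (rule oce_measurable[OF _ K_measurable prob]) measurable
    show "(\<lambda>\<omega>. oce \<phi> (K \<omega>) (\<lambda>x. max (- C) (min C x))) \<in> borel_measurable M"
      by (rule oce_measurable[OF _ K_measurable prob]) measurable
  qed
qed

lemma Linf_boundE:
  assumes "Linf M X"
  obtains C where "X \<in> borel_measurable M" "\<And>\<omega>. \<omega> \<in> space M \<Longrightarrow> \<bar>X \<omega>\<bar> \<le> C" "0 \<le> C"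
proof -
  obtain C where "\<And>\<omega>. \<omega> \<in> space M \<Longrightarrow> \<bar>X \<omega>\<bar> \<le> C"
    using assms unfolding Linf_def bounded_iff by auto
  then show ?thesis
    using assms by (intro that[of "max 0 C"]) (force simp: Linf_def)+
qed

lemma (in oce_function) acceptance_consistentI:
  assumes H: "\<And>x y. 0 \<le> x \<Longrightarrow> 0 \<le> y \<Longrightarrow>
      ereal y * conj_fun \<phi> x + ereal x * conj_fun \<phi> y \<le> conj_fun \<phi> (x * y)"
    and M: "prob_space M"
  shows "acceptance_consistent \<phi> M"
  unfolding acceptance_consistent_def
proof (intro allI impI)
  fix X G K assume "Linf M X" and G: "subalgebra M G" and K: "reg_cond_law M G X K"
  from \<open>Linf M X\<close> obtain C where X: "X \<in> borel_measurable M" "\<And>\<omega>. \<omega> \<in> space M \<Longrightarrow> \<bar>X \<omega>\<bar> \<le> C" "0 \<le> C"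
    by (rule Linf_boundE) blast
  note hyps = oce_function_axioms M G K X
  interpret oce_disintegration \<phi> M X M K borel "\<lambda>\<omega> x. max (- C) (min C x)" C
    by (rule oce_disintegration_reg_cond_law[OF hyps])
  have le: "oce \<phi> M X \<le> oce \<phi> M cond" by (rule oce_le_oce_cond) (rule H)
  show "oce \<phi> M X \<le> oce \<phi> M (cond_oce \<phi> K)"
    using le by (simp add: oce_cond_oce_eq[OF hyps] cond_def[abs_def])
qed

lemma (in oce_function) rejection_consistentI:
  assumes H: "\<And>x y. 0 \<le> x \<Longrightarrow> 0 \<le> y \<Longrightarrow>
      conj_fun \<phi> (x * y) \<le> ereal y * conj_fun \<phi> x + ereal x * conj_fun \<phi> y"
    and M: "prob_space M"
  shows "rejection_consistent \<phi> M"
  unfolding rejection_consistent_def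
proof (intro allI impI)
  fix X G K assume "Linf M X" and G: "subalgebra M G" and K: "reg_cond_law M G X K"
  from \<open>Linf M X\<close> obtain C where X: "X \<in> borel_measurable M" "\<And>\<omega>. \<omega> \<in> space M \<Longrightarrow> \<bar>X \<omega>\<bar> \<le> C" "0 \<le> C"
    by (rule Linf_boundE) blast
  note hyps = oce_function_axioms M G K X
  interpret oce_disintegration \<phi> M X M K borel "\<lambda>\<omega> x. max (- C) (min C x)" C
    by (rule oce_disintegration_reg_cond_law[OF hyps])
  have le: "oce \<phi> M cond \<le> oce \<phi> M X" by (rule oce_cond_le_oce) (rule H)
  show "oce \<phi> M X \<ge> oce \<phi> M (cond_oce \<phi> K)"
    using le by (simp add: oce_cond_oce_eq[OF hyps] cond_def[abs_def])
qed

section \<open>Superadditivity\<close>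

lemma Borel_approx_finite_Union:
  fixes \<B> :: "'f::polish_space set set"
  assumes \<B>: "topological_basis \<B>" and A: "A \<in> sets borel"
    and \<mu>: "\<And>i::bool. finite_measure (\<mu> i)" "\<And>i. sets (\<mu> i) = sets borel" and "e > 0"
  obtains S where "finite S" "S \<subseteq> \<B>" "\<And>i. measure (\<mu> i) (A - \<Union>S \<union> (\<Union>S - A)) < e"
proof -
  interpret \<mu>: finite_measure "\<mu> i" for i by (rule \<mu>)
  have "\<exists>V. A \<subseteq> V \<and> open V \<and> measure (\<mu> i) (V - A) < e / 2" for i
  proof -
    have "emeasure (\<mu> i) A < emeasure (\<mu> i) A + ennreal (e / 2)"
      using \<open>e > 0\<close> by (simp add: \<mu>.emeasure_eq_measure ennreal_plus[symmetric] ennreal_less_iff del: ennreal_plus)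
    then have "(INF U \<in> {U. A \<subseteq> U \<and> open U}. emeasure (\<mu> i) U) < emeasure (\<mu> i) A + ennreal (e / 2)"
      using outer_regular[OF \<mu>(2) _ A, of i] by (simp add: infinity_ennreal_def)
    then obtain V where V: "A \<subseteq> V" "open V" "emeasure (\<mu> i) V < emeasure (\<mu> i) A + ennreal (e / 2)"
      unfolding INF_less_iff by auto
    then have "measure (\<mu> i) V < measure (\<mu> i) A + e / 2"
      using \<open>e > 0\<close> by (simp add: \<mu>.emeasure_eq_measure ennreal_plus[symmetric] ennreal_less_iff del: ennreal_plus)
    with V A show ?thesis by (auto simp: \<mu>.finite_measure_Diff \<mu>(2))
  qed
  then obtain V where V: "\<And>i. A \<subseteq> V i" "\<And>i. open (V i)" "\<And>i. measure (\<mu> i) (V i - A) < e / 2" by metis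
  \<comment> \<open>A test function has to be good for nu and for mu, hence the pair of measures;
    intersecting the two outer approximations serves both.\<close>
  define U where "U = V True \<inter> V False"
  have "open U" "A \<subseteq> U" using V by (auto simp: U_def)
  have U_A: "measure (\<mu> i) (U - A) < e / 2" for i
  proof -
    have "measure (\<mu> i) (U - A) \<le> measure (\<mu> i) (V i - A)"
      using A V(2)[of i] by (intro \<mu>.finite_measure_mono) (cases i; auto simp: U_def \<mu>(2))+
    with V(3)[of i] show ?thesis by simp
  qed
  obtain B' where B': "B' \<subseteq> \<B>" "\<Union>B' = U"
    using \<B> \<open>open U\<close> unfolding topological_basis_def by blast
  obtain B'' where B'': "B'' \<subseteq> B'" "countable B''" "\<Union>B'' = U"
    using Lindelof[of B'] B' topological_basis_open[OF \<B>] by (metis subsetD)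
  \<comment> \<open>Finite unions of basic sets increase to \<open>U\<close>, so continuity from
    below applies. The empty set is adjoined to make the enumerated family nonempty and is removed
    again in \<open>S\<close>, since it need not belong to the basis.\<close>
  define W where "W n = \<Union>(from_nat_into (insert {} B'') ` {..n})" for n
  have rng: "range (from_nat_into (insert {} B'')) = insert {} B''"
    using B''(2) by (intro range_from_nat_into) auto
  have "incseq W" unfolding W_def by (intro incseq_SucI UN_mono Union_mono) auto
  have "(\<Union>n. W n) = \<Union>(range (from_nat_into (insert {} B'')))" unfolding W_def by auto
  then have W: "(\<Union>n. W n) = U" using B''(3) by (simp add: rng)
  have fin: "from_nat_into (insert {} B'') n = {} \<or> from_nat_into (insert {} B'') n \<in> \<B>" for n
    using rng B'' B' by (metis insertE rangeI subsetD)
  have W_open: "open (W n)" for n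
    unfolding W_def using fin topological_basis_open[OF \<B>] by (intro open_Union) (metis imageE open_empty)
  have "\<forall>\<^sub>F n in sequentially. measure (\<mu> i) (U - W n) < e / 2" for i
  proof -
    have "range W \<subseteq> sets (\<mu> i)" using borel_open[OF W_open] by (auto simp: \<mu>(2))
    then have "(\<lambda>n. measure (\<mu> i) (W n)) \<longlonglongrightarrow> measure (\<mu> i) U"
      using \<mu>.finite_Lim_measure_incseq[of W i] \<open>incseq W\<close> by (simp add: W)
    then have "\<forall>\<^sub>F n in sequentially. measure (\<mu> i) U - e / 2 < measure (\<mu> i) (W n)"
      using \<open>e > 0\<close> by (intro order_tendstoD) auto
    then show ?thesis
    proof eventually_elim
      case (elim n)
      have "W n \<subseteq> U" using W by auto
      with elim W_open[of n] \<open>open U\<close> show ?case by (simp add: \<mu>.finite_measure_Diff \<mu>(2))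
    qed
  qed
  from eventually_conj[OF this[of True] this[of False]]
  obtain n where n: "measure (\<mu> True) (U - W n) < e / 2" "measure (\<mu> False) (U - W n) < e / 2"
    by (auto dest: eventually_happens)
  define S where "S = from_nat_into (insert {} B'') ` {..n} - {{}}"
  have S: "\<Union>S = W n" by (auto simp: S_def W_def)
  show ?thesis
  proof (rule that[of S])
    show "finite S" by (simp add: S_def)
    show "S \<subseteq> \<B>" using fin unfolding S_def by blast
    fix i
    have "measure (\<mu> i) (A - \<Union>S \<union> (\<Union>S - A)) \<le> measure (\<mu> i) ((U - W n) \<union> (U - A))"
      unfolding S using A W W_open \<open>open U\<close> \<open>A \<subseteq> U\<close>
      by (intro \<mu>.finite_measure_mono) (auto simp: \<mu>(2))
    also have "\<dots> \<le> measure (\<mu> i) (U - W n) + measure (\<mu> i) (U - A)"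
      using A W_open \<open>open U\<close> by (intro measure_Un_le) (auto simp: \<mu>(2))
    also have "\<dots> < e" using n U_A[of i] by (cases i) auto
    finally show "measure (\<mu> i) (A - \<Union>S \<union> (\<Union>S - A)) < e" .
  qed
qed

text \<open>Coding by lists makes the family countable when the basis is, and turns concatenation
  into addition; the sets in a list may overlap.\<close>

definition step_fun :: "(rat \<times> 'f set set) list \<Rightarrow> 'f \<Rightarrow> real" where
  "step_fun l x = (\<Sum>(q, S)\<leftarrow>l. of_rat q * indicator (\<Union>S) x)"

definition step_lists :: "'f set set \<Rightarrow> (rat \<times> 'f set set) list set" where
  "step_lists \<B> = lists (UNIV \<times> {S. finite S \<and> S \<subseteq> \<B>})"

lemma step_fun_simps [simp]:
  "step_fun [] x = 0"
  "step_fun ((q, S) # l) x = of_rat q * indicator (\<Union>S) x + step_fun l x"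
  "step_fun (l @ l') x = step_fun l x + step_fun l' x"
  by (simp_all add: step_fun_def)

lemma countable_step_lists:
  assumes "countable \<B>"
  shows "countable (step_lists \<B>)"
  unfolding step_lists_def
  by (intro countable_lists countable_SIGMA countable_Collect_finite_subset assms) auto

lemma step_fun_measurable:
  assumes "topological_basis \<B>" "l \<in> step_lists \<B>"
  shows "step_fun l \<in> borel_measurable borel"
  using assms(2)
proof (induction l)
  case (Cons a l)
  obtain q S where [simp]: "a = (q, S)" by (cases a)
  have "S \<subseteq> \<B>" "l \<in> step_lists \<B>" using Cons.prems by (auto simp: step_lists_def)
  then have "open (\<Union>S)" using topological_basis_open[OF assms(1)] by (intro open_Union) auto
  then have [measurable]: "\<Union>S \<in> sets borel" by (rule borel_open)
  note [measurable] = Cons.IH[OF \<open>l \<in> step_lists \<B>\<close>]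
  have "step_fun (a # l) = (\<lambda>x. of_rat q * indicator (\<Union>S) x + step_fun l x)"
    by (simp only: fun_eq_iff step_fun_simps \<open>a = (q, S)\<close> simp_thms)
  then show ?case by (simp only:) measurable
next
  case Nil
  have "step_fun [] = (\<lambda>x. 0)" by (simp add: fun_eq_iff)
  then show ?case by simp
qed

lemma step_fun_bound: "\<bar>step_fun l x\<bar> \<le> (\<Sum>(q, S)\<leftarrow>l. \<bar>of_rat q\<bar>)"
proof (induction l)
  case (Cons a l)
  obtain q S where [simp]: "a = (q, S)" by (cases a)
  have "\<bar>of_rat q * indicator (\<Union>S) x\<bar> \<le> \<bar>of_rat q :: real\<bar>" by (simp add: indicator_def)
  moreover have "step_fun (a # l) x = of_rat q * indicator (\<Union>S) x + step_fun l x"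
    by (simp only: step_fun_simps \<open>a = (q, S)\<close>)
  moreover have "(\<Sum>(q, S)\<leftarrow>a # l. \<bar>of_rat q :: real\<bar>) = \<bar>of_rat q\<bar> + (\<Sum>(q, S)\<leftarrow>l. \<bar>of_rat q\<bar>)"
    by simp
  ultimately show ?case using Cons.IH by linarith
qed simp

context
  fixes \<B> :: "'f::polish_space set set" and \<mu> :: "bool \<Rightarrow> 'f measure"
  assumes \<B>: "topological_basis \<B>"
    and \<mu>: "\<And>i. finite_measure (\<mu> i)" "\<And>i. sets (\<mu> i) = sets borel"
begin

interpretation \<mu>: finite_measure "\<mu> i" for i by (rule \<mu>)

private lemma bounded_integrable:
  assumes "f \<in> borel_measurable borel" "\<And>x. \<bar>f x\<bar> \<le> (C::real)"
  shows "integrable (\<mu> i) f"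
  using assms by (intro \<mu>.integrable_const_bound[where B = C]) (simp_all cong: measurable_cong_sets add: \<mu>(2))

private lemma step_fun_integrable: "l \<in> step_lists \<B> \<Longrightarrow> integrable (\<mu> i) (step_fun l)"
  by (rule bounded_integrable[OF step_fun_measurable[OF \<B>] step_fun_bound])

private definition approximable :: "('f \<Rightarrow> real) \<Rightarrow> bool" where
  "approximable f \<longleftrightarrow> (\<forall>e>0. \<exists>l\<in>step_lists \<B>. \<forall>i. (\<integral>x. \<bar>f x - step_fun l x\<bar> \<partial>\<mu> i) < e)"

private lemma approximable_indicator:
  assumes A: "A \<in> sets borel"
  shows "approximable (\<lambda>x. of_rat q * indicator A x)"
  unfolding approximable_def
proof (intro allI impI)
  fix e :: real assume "e > 0"
  \<comment> \<open>The summand 1 keeps the divisor positive when \<open>q\<close> is 0.\<close>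
  define r where "r = \<bar>of_rat q :: real\<bar> + 1"
  have "r > 0" using abs_ge_zero[of "of_rat q :: real"] unfolding r_def by linarith
  with \<open>e > 0\<close> have "e / r > 0" by simp
  obtain S where S: "finite S" "S \<subseteq> \<B>" and
    S_A: "\<And>i. measure (\<mu> i) (A - \<Union>S \<union> (\<Union>S - A)) < e / r"
    by (rule Borel_approx_finite_Union[where \<mu> = \<mu>, OF \<B> A \<mu> \<open>e / r > 0\<close>]) blast
  let ?D = "A - \<Union>S \<union> (\<Union>S - A)"
  have "open (\<Union>S)" using topological_basis_open[OF \<B>] S(2) by (intro open_Union) auto
  then have D: "?D \<in> sets (\<mu> i)" for i using A by (simp add: \<mu>(2))
  have "(\<integral>x. \<bar>of_rat q * indicator A x - step_fun [(q, S)] x\<bar> \<partial>\<mu> i) < e" for i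
  proof -
    have "(\<integral>x. \<bar>of_rat q * indicator A x - step_fun [(q, S)] x\<bar> \<partial>\<mu> i) = (\<integral>x. \<bar>of_rat q\<bar> * indicator ?D x \<partial>\<mu> i)"
      by (intro Bochner_Integration.integral_cong) (auto simp: indicator_def)
    also have "\<dots> = \<bar>of_rat q\<bar> * measure (\<mu> i) ?D"
      using D[of i] by simp
    also have "\<dots> \<le> r * measure (\<mu> i) ?D" by (intro mult_right_mono measure_nonneg) (simp add: r_def)
    also have "\<dots> < r * (e / r)" using S_A[of i] \<open>r > 0\<close> by (intro mult_strict_left_mono)
    finally show ?thesis using \<open>r > 0\<close> by simp
  qed
  moreover have "[(q, S)] \<in> step_lists \<B>" using S by (simp add: step_lists_def)
  ultimately show "\<exists>l\<in>step_lists \<B>. \<forall>i. (\<integral>x. \<bar>of_rat q * indicator A x - step_fun l x\<bar> \<partial>\<mu> i) < e"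
    by blast
qed

private lemma approximable_add:
  assumes "approximable f" "approximable g" and int: "\<And>i. integrable (\<mu> i) f" "\<And>i. integrable (\<mu> i) g"
  shows "approximable (\<lambda>x. f x + g x)"
  unfolding approximable_def
proof (intro allI impI)
  fix e :: real assume "e > 0"
  then have "e / 2 > 0" by simp
  obtain l where l: "l \<in> step_lists \<B>" "\<And>i. (\<integral>x. \<bar>f x - step_fun l x\<bar> \<partial>\<mu> i) < e / 2"
    using assms(1) \<open>e / 2 > 0\<close> unfolding approximable_def by blast
  obtain k where k: "k \<in> step_lists \<B>" "\<And>i. (\<integral>x. \<bar>g x - step_fun k x\<bar> \<partial>\<mu> i) < e / 2"
    using assms(2) \<open>e / 2 > 0\<close> unfolding approximable_def by blast
  note [simp] = step_fun_integrable[OF l(1)] step_fun_integrable[OF k(1)] int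
  have "(\<integral>x. \<bar>f x + g x - step_fun (l @ k) x\<bar> \<partial>\<mu> i) < e" for i
  proof -
    have "(\<integral>x. \<bar>f x + g x - step_fun (l @ k) x\<bar> \<partial>\<mu> i)
        \<le> (\<integral>x. \<bar>f x - step_fun l x\<bar> + \<bar>g x - step_fun k x\<bar> \<partial>\<mu> i)"
      by (intro integral_mono integrable_abs Bochner_Integration.integrable_add
          Bochner_Integration.integrable_diff) auto
    also have "\<dots> = (\<integral>x. \<bar>f x - step_fun l x\<bar> \<partial>\<mu> i) + (\<integral>x. \<bar>g x - step_fun k x\<bar> \<partial>\<mu> i)" by simp
    finally show ?thesis using l(2)[of i] k(2)[of i] by simp
  qed
  moreover have "l @ k \<in> step_lists \<B>" using l k by (simp add: step_lists_def)
  ultimately show "\<exists>l\<in>step_lists \<B>. \<forall>i. (\<integral>x. \<bar>f x + g x - step_fun l x\<bar> \<partial>\<mu> i) < e" by blast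
qed

private lemma approximable_sum:
  assumes "finite I" "\<And>k. A k \<in> sets borel"
  shows "approximable (\<lambda>x. \<Sum>k\<in>I. of_rat (q k) * indicator (A k) x)"
  using assms(1)
proof induction
  case empty
  have "[] \<in> step_lists \<B>" by (simp add: step_lists_def)
  then show ?case unfolding approximable_def by (auto intro!: bexI[of _ "[]"])
next
  case (insert k I)
  have int: "integrable (\<mu> i) (\<lambda>x. of_rat (q k) * indicator (A k) x :: real)" for k i
    using assms(2)[of k] by (simp add: \<mu>(2) \<mu>.emeasure_finite less_top[symmetric])
  show ?case unfolding sum.insert[OF insert.hyps]
    by (intro approximable_add approximable_indicator insert.IH int Bochner_Integration.integrable_sum assms(2))
qed

text \<open>Rounding \<open>f\<close> down to multiples of 1/n gives finitely many rational values
  on Borel level sets, and each level set is approximated by a finite union of basic sets.\<close>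

lemma bounded_approx_step_fun:
  assumes f [measurable]: "f \<in> borel_measurable borel" and bound: "\<And>x. \<bar>f x\<bar> \<le> C" and "e > 0"
  obtains l where "l \<in> step_lists \<B>" "\<And>i. (\<integral>x. \<bar>f x - step_fun l x\<bar> \<partial>\<mu> i) < e"
proof -
  define T where "T = measure (\<mu> True) (space (\<mu> True)) + measure (\<mu> False) (space (\<mu> False))"
  have T: "measure (\<mu> i) (space (\<mu> i)) \<le> T" for i by (cases i) (auto simp: T_def)
  have "T \<ge> 0" by (simp add: T_def)
  \<comment> \<open>Rounding costs at most 1/n pointwise, hence at most T/n in either integral; this
    choice makes \<open>(T + 1) / real n\<close> less than e/2.\<close>
  obtain n :: nat where n: "2 * (T + 1) / e < real n" using reals_Archimedean2 by blast
  have "0 < 2 * (T + 1) / e" using \<open>T \<ge> 0\<close> \<open>e > 0\<close> by simp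
  with n have "real n > 0" by linarith
  define s where "s x = real_of_int \<lfloor>real n * f x\<rfloor> / real n" for x
  define N where "N = \<lceil>real n * C\<rceil> + 1"
  have N: "\<lfloor>real n * f x\<rfloor> \<in> {- N..N}" for x
  proof -
    have "\<bar>real n * f x\<bar> \<le> real n * C" using bound[of x] by (simp add: abs_mult mult_left_mono)
    then show ?thesis unfolding N_def by (auto simp: abs_le_iff) linarith+
  qed
  define A where "A k = {x. \<lfloor>real n * f x\<rfloor> = k}" for k
  have A: "A k \<in> sets borel" for k unfolding A_def by measurable
  have s_sum: "s x = (\<Sum>k\<in>{- N..N}. of_rat (rat_of_int k / rat_of_nat n) * indicator (A k) x)" for x
  proof -
    have "(\<Sum>k\<in>{- N..N}. of_rat (rat_of_int k / rat_of_nat n) * indicator (A k) x)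
        = (\<Sum>k\<in>{- N..N}. if k = \<lfloor>real n * f x\<rfloor> then s x else 0)"
      by (intro sum.cong) (auto simp: A_def s_def of_rat_divide)
    also have "\<dots> = s x" using N[of x] by (simp add: sum.delta)
    finally show ?thesis by simp
  qed
  have "approximable s"
    unfolding s_sum[abs_def] by (rule approximable_sum[OF _ A]) simp
  then obtain l where l: "l \<in> step_lists \<B>" "\<And>i. (\<integral>x. \<bar>s x - step_fun l x\<bar> \<partial>\<mu> i) < e / 2"
    using \<open>e > 0\<close> unfolding approximable_def by (meson half_gt_zero)
  have f_s: "\<bar>f x - s x\<bar> \<le> 1 / real n" for x
  proof -
    have "\<bar>real n * f x - real_of_int \<lfloor>real n * f x\<rfloor>\<bar> \<le> 1" by linarith
    then have "\<bar>real n * f x - real_of_int \<lfloor>real n * f x\<rfloor>\<bar> / real n \<le> 1 / real n"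
      by (intro divide_right_mono) auto
    moreover have "\<bar>real n * f x - real_of_int \<lfloor>real n * f x\<rfloor>\<bar> / real n
        = \<bar>(real n * f x - real_of_int \<lfloor>real n * f x\<rfloor>) / real n\<bar>" by simp
    moreover have "(real n * f x - real_of_int \<lfloor>real n * f x\<rfloor>) / real n = f x - s x"
      using \<open>real n > 0\<close> by (simp add: s_def diff_divide_distrib)
    ultimately show ?thesis by simp
  qed
  have s [measurable]: "s \<in> borel_measurable borel" unfolding s_def by measurable
  have int_s: "integrable (\<mu> i) s" for i
  proof (rule bounded_integrable[OF s])
    fix x show "\<bar>s x\<bar> \<le> C + 1 / real n" using f_s[of x] bound[of x] by linarith
  qed
  note [simp] = int_s bounded_integrable[OF f bound] step_fun_integrable[OF l(1)]
  show ?thesis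
  proof (rule that[OF l(1)])
    fix i
    have "(\<integral>x. \<bar>f x - step_fun l x\<bar> \<partial>\<mu> i) \<le> (\<integral>x. 1 / real n + \<bar>s x - step_fun l x\<bar> \<partial>\<mu> i)"
    proof (rule integral_mono)
      fix x show "\<bar>f x - step_fun l x\<bar> \<le> 1 / real n + \<bar>s x - step_fun l x\<bar>"
        using f_s[of x] by linarith
    qed simp_all
    also have "\<dots> = measure (\<mu> i) (space (\<mu> i)) / real n + (\<integral>x. \<bar>s x - step_fun l x\<bar> \<partial>\<mu> i)" by simp
    also have "\<dots> < (T + 1) / real n + e / 2"
      using T[of i] l(2)[of i] \<open>real n > 0\<close> by (intro add_strict_mono divide_strict_right_mono) auto
    also have "\<dots> \<le> e" using n \<open>e > 0\<close> \<open>real n > 0\<close> by (simp add: field_simps)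
    finally show "(\<integral>x. \<bar>f x - step_fun l x\<bar> \<partial>\<mu> i) < e" .
  qed
qed

end

section \<open>Reduction to countably many test functions and measurable selection\<close>

context oce_function
begin

text \<open>Closeness in L1(nu) controls the linear term, closeness in L1(mu) the certainty
  equivalent through the Lipschitz bound. Clamping to [-n, n] with \<open>C \<le> real n\<close>
  fixes the Lipschitz constant before \<open>l\<close> is chosen; being nonexpansive and leaving
  \<open>f\<close> unchanged, it does not increase the distance.\<close>

lemma near_optimal_step_fun:
  fixes f :: "'f::polish_space \<Rightarrow> real"
  assumes \<B>: "topological_basis \<B>" and \<nu>: "prob_on \<nu>" and \<mu>: "prob_on \<mu>"
    and f [measurable]: "f \<in> borel_measurable borel" and bound: "\<And>x. \<bar>f x\<bar> \<le> C" and "e > 0"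
  obtains n l where "l \<in> step_lists \<B>"
    "(\<integral>x. f x \<partial>\<nu>) - oce \<phi> \<mu> f
      \<le> (\<integral>x. max (- real n) (min (real n) (step_fun l x)) \<partial>\<nu>)
          - oce \<phi> \<mu> (\<lambda>x. max (- real n) (min (real n) (step_fun l x))) + e"
proof -
  interpret \<nu>: prob_space \<nu> using \<nu> by (simp add: prob_on_def)
  interpret \<mu>: prob_space \<mu> using \<mu> by (simp add: prob_on_def)
  have sets: "sets \<nu> = sets borel" "sets \<mu> = sets borel" using \<nu> \<mu> by (auto simp: prob_on_def)
  obtain n :: nat where n: "C \<le> real n" using real_arch_simple by blast
  have f_n: "\<bar>f x\<bar> \<le> real n" for x using bound[of x] n by linarith
  interpret f: oce_function_prob \<phi> \<mu> f "real n"
    by unfold_locales (simp_all cong: measurable_cong_sets add: sets f_n f)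
  have "e / 3 > 0" using \<open>e > 0\<close> by simp
  then obtain m where m: "(\<integral>x. \<phi> (m + f x) \<partial>\<mu>) - m < oce \<phi> \<mu> f + e / 3" by (rule f.near_oce)
  \<comment> \<open>The summand 1 keeps the divisor positive. One third of \<open>e\<close> goes to
    the integral under nu, one to the choice of \<open>m\<close>, and one to the Lipschitz error
    with its factor \<open>L\<close>.\<close>
  define L where "L = slope (m + real n) + 1"
  have "L > 0" unfolding L_def using slope_nonneg[of "m + real n"] by linarith
  then have d: "min (e / 3) (e / 3 / L) > 0" using \<open>e > 0\<close> by simp
  let ?M = "\<lambda>i. if i then \<nu> else \<mu>"
  have M: "finite_measure (?M i)" "sets (?M i) = sets borel" for i
    using \<nu>.finite_measure_axioms \<mu>.finite_measure_axioms sets by auto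
  obtain l where l: "l \<in> step_lists \<B>"
    and l_approx: "\<And>i. (\<integral>x. \<bar>f x - step_fun l x\<bar> \<partial>?M i) < min (e / 3) (e / 3 / L)"
    by (rule bounded_approx_step_fun[where \<mu> = ?M, OF \<B> M f bound d]) blast
  define c where "c x = max (- real n) (min (real n) (step_fun l x))" for x
  have c [measurable]: "c \<in> borel_measurable borel"
    unfolding c_def using step_fun_measurable[OF \<B> l] by measurable
  have c_n: "\<bar>c x\<bar> \<le> real n" for x by (auto simp: c_def)
  interpret c: oce_function_prob \<phi> \<mu> c "real n"
    by unfold_locales (simp_all cong: measurable_cong_sets add: sets c_n c)
  have int: "integrable (?M i) f" "integrable (?M i) c" "integrable (?M i) (step_fun l)" for i
  proof -
    interpret finite_measure "?M i" by (rule M)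
    have *: "integrable (?M i) g" if "g \<in> borel_measurable borel" "\<And>x. \<bar>g x\<bar> \<le> B" for g and B :: real
      using that by (intro integrable_const_bound[where B = B]) (simp_all only: measurable_cong_sets[OF M(2) refl], auto)
    show "integrable (?M i) f" by (rule *[OF f f_n])
    show "integrable (?M i) c" by (rule *[OF c c_n])
    show "integrable (?M i) (step_fun l)" by (rule *[OF step_fun_measurable[OF \<B> l] step_fun_bound])
  qed
  have close: "(\<integral>x. \<bar>f x - c x\<bar> \<partial>?M i) < min (e / 3) (e / 3 / L)" for i
  proof -
    have "(\<integral>x. \<bar>f x - c x\<bar> \<partial>?M i) \<le> (\<integral>x. \<bar>f x - step_fun l x\<bar> \<partial>?M i)"
    proof (rule integral_mono)
      fix x show "\<bar>f x - c x\<bar> \<le> \<bar>f x - step_fun l x\<bar>"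
        using f_n[of x] unfolding c_def by linarith
    qed (use int[of i] in auto)
    with l_approx[of i] show ?thesis by linarith
  qed
  have "(\<integral>x. f x \<partial>\<nu>) - (\<integral>x. c x \<partial>\<nu>) = (\<integral>x. f x - c x \<partial>\<nu>)"
    using int[of True] by simp
  also have "\<dots> \<le> (\<integral>x. \<bar>f x - c x\<bar> \<partial>\<nu>)"
    using int[of True] by (intro integral_mono) auto
  finally have 1: "(\<integral>x. f x \<partial>\<nu>) \<le> (\<integral>x. c x \<partial>\<nu>) + e / 3" using close[of True] by simp
  have "(\<integral>x. \<phi> (m + c x) \<partial>\<mu>) \<le> (\<integral>x. \<phi> (m + f x) + L * \<bar>f x - c x\<bar> \<partial>\<mu>)"
  proof (rule integral_mono)
    show "integrable \<mu> (\<lambda>x. \<phi> (m + f x) + L * \<bar>f x - c x\<bar>)" using int[of False] by simp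
    fix x
    have "slope (m + real n) * \<bar>c x - f x\<bar> \<le> L * \<bar>c x - f x\<bar>"
      by (intro mult_right_mono) (auto simp: L_def)
    then show "\<phi> (m + c x) \<le> \<phi> (m + f x) + L * \<bar>f x - c x\<bar>"
      using local_lipschitz[OF c_n[of x] f_n[of x], of m] by (simp add: abs_minus_commute)
  qed simp
  also have "\<dots> = (\<integral>x. \<phi> (m + f x) \<partial>\<mu>) + L * (\<integral>x. \<bar>f x - c x\<bar> \<partial>\<mu>)"
    using int[of False] by simp
  also have "L * (\<integral>x. \<bar>f x - c x\<bar> \<partial>\<mu>) \<le> L * (e / 3 / L)"
    using close[of False] \<open>L > 0\<close> by (intro mult_left_mono) auto
  finally have "oce \<phi> \<mu> c \<le> oce \<phi> \<mu> f + e / 3 + e / 3"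
    using m c.oce_le[of m] \<open>L > 0\<close> by simp
  with 1 have "(\<integral>x. f x \<partial>\<nu>) - oce \<phi> \<mu> f \<le> (\<integral>x. c x \<partial>\<nu>) - oce \<phi> \<mu> c + e" by simp
  then show ?thesis using l unfolding c_def by (intro that)
qed

text \<open>The supremum defining the divergence may be taken over a fixed sequence of functions; this
  provides the measurable selection of near-optimal functions for a kernel.\<close>
lemma ind_div_eq_SUP:
  obtains h :: "nat \<Rightarrow> 'f::polish_space \<Rightarrow> real" and B :: "nat \<Rightarrow> real" where
    "\<And>n. h n \<in> borel_measurable borel" "\<And>n x. \<bar>h n x\<bar> \<le> B n" "\<And>x. h 0 x = 0"
    "\<And>\<nu> \<mu>. prob_on \<nu> \<Longrightarrow> prob_on \<mu> \<Longrightarrow>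
      ind_div \<phi> \<nu> \<mu> \<le> (SUP n. ereal ((\<integral>x. h n x \<partial>\<nu>) - oce \<phi> \<mu> (h n)))"
proof -
  obtain \<B> :: "'f set set" where \<B>: "countable \<B>" "topological_basis \<B>"
    using ex_countable_basis by blast
  define I where "I = (UNIV :: nat set) \<times> step_lists \<B>"
  define F where "F = (\<lambda>(n::nat, l) (x::'f). max (- real n) (min (real n) (step_fun l x)))"
  have I: "countable I" "(0, []) \<in> I"
    unfolding I_def using countable_step_lists[OF \<B>(1)] by (auto simp: step_lists_def)
  \<comment> \<open>Index 0 is reserved for the zero function, from which the selection starts; the
    enumeration of the codes follows from index 1 on.\<close>
  define h where "h k = (case k of 0 \<Rightarrow> F (0, []) | Suc j \<Rightarrow> F (from_nat_into I j))" for k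
  define B where "B k = (case k of 0 \<Rightarrow> 0 | Suc j \<Rightarrow> real (fst (from_nat_into I j)))" for k
  have F_meas: "F p \<in> borel_measurable borel" if "p \<in> I" for p
    using that step_fun_measurable[OF \<B>(2), of "snd p"] unfolding F_def I_def by (auto simp: case_prod_beta)
  have F_bound: "\<bar>F p x\<bar> \<le> real (fst p)" for p x by (auto simp: F_def case_prod_beta)
  have mem: "from_nat_into I j \<in> I" for j using I(2) by (intro from_nat_into) auto
  show ?thesis
  proof (rule that[of h B])
    show "h n \<in> borel_measurable borel" for n
      using F_meas I(2) mem by (auto simp: h_def split: nat.split)
    show "\<bar>h n x\<bar> \<le> B n" for n x
      using F_bound[of "(0, [])" x] F_bound[of "from_nat_into I (n - 1)" x]
      by (auto simp: h_def B_def split: nat.split)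
    show "h 0 x = 0" for x by (simp add: h_def F_def)
    fix \<nu> \<mu> :: "'f measure" assume \<nu>: "prob_on \<nu>" and \<mu>: "prob_on \<mu>"
    show "ind_div \<phi> \<nu> \<mu> \<le> (SUP n. ereal ((\<integral>x. h n x \<partial>\<nu>) - oce \<phi> \<mu> (h n)))"
      unfolding ind_div_def
    proof (rule SUP_least)
      fix f :: "'f \<Rightarrow> real" assume "f \<in> {f. f \<in> borel_measurable borel \<and> bounded (range f)}"
      then obtain C where f: "f \<in> borel_measurable borel" and bound: "\<And>x. \<bar>f x\<bar> \<le> C"
        by (auto simp: bounded_iff)
      show "ereal ((\<integral>x. f x \<partial>\<nu>) - oce \<phi> \<mu> f) \<le> (SUP n. ereal ((\<integral>x. h n x \<partial>\<nu>) - oce \<phi> \<mu> (h n)))"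
      proof (rule ereal_le_epsilon2)
        fix e :: real assume "0 < e"
        obtain n l where l: "l \<in> step_lists \<B>" and le: "(\<integral>x. f x \<partial>\<nu>) - oce \<phi> \<mu> f
            \<le> (\<integral>x. max (- real n) (min (real n) (step_fun l x)) \<partial>\<nu>)
              - oce \<phi> \<mu> (\<lambda>x. max (- real n) (min (real n) (step_fun l x))) + e"
          by (rule near_optimal_step_fun[OF \<B>(2) \<nu> \<mu> f bound \<open>0 < e\<close>]) blast
        have "(n, l) \<in> I" using l by (simp add: I_def)
        then obtain j where "from_nat_into I j = (n, l)" using from_nat_into_surj[OF I(1)] by blast
        then have "h (Suc j) = (\<lambda>x. max (- real n) (min (real n) (step_fun l x)))"
          by (simp add: h_def F_def)
        with le have "ereal ((\<integral>x. f x \<partial>\<nu>) - oce \<phi> \<mu> f)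
            \<le> ereal ((\<integral>x. h (Suc j) x \<partial>\<nu>) - oce \<phi> \<mu> (h (Suc j))) + ereal e" by simp
        also have "\<dots> \<le> (SUP n. ereal ((\<integral>x. h n x \<partial>\<nu>) - oce \<phi> \<mu> (h n))) + ereal e"
          by (intro add_right_mono SUP_upper) simp
        finally show "ereal ((\<integral>x. f x \<partial>\<nu>) - oce \<phi> \<mu> f)
            \<le> (SUP n. ereal ((\<integral>x. h n x \<partial>\<nu>) - oce \<phi> \<mu> (h n))) + ereal e" .
      qed
    qed
  qed
qed

text \<open>Replacing \<open>m\<close> by \<open>m + b\<close> absorbs the constant. One inequality
  is shown for all functions and constants; the other is the same inequality for the shift
  back.\<close>

lemma oce_diff_const:
  assumes "prob_space P" "f \<in> borel_measurable P" "\<And>x. x \<in> space P \<Longrightarrow> \<bar>f x\<bar> \<le> C"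
  shows "oce \<phi> P (\<lambda>x. f x - a) = oce \<phi> P f - a"
proof -
  have le: "oce \<phi> P (\<lambda>x. g x - b) \<le> oce \<phi> P g - b"
    if g: "g \<in> borel_measurable P" "\<And>x. x \<in> space P \<Longrightarrow> \<bar>g x\<bar> \<le> D" for g b D
  proof (rule field_le_epsilon)
    fix e :: real assume "e > 0"
    interpret g: oce_function_prob \<phi> P g D
      using assms(1) g by (intro oce_function_prob.intro oce_function_axioms oce_function_prob_axioms.intro)
    interpret g': oce_function_prob \<phi> P "\<lambda>x. g x - b" "D + \<bar>b\<bar>"
    proof unfold_locales
      show "(\<lambda>x. g x - b) \<in> borel_measurable P" using g by measurable
      show "\<bar>g x - b\<bar> \<le> D + \<bar>b\<bar>" if "x \<in> space P" for x using g(2)[OF that] by linarith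
    qed
    obtain m where "(\<integral>x. \<phi> (m + g x) \<partial>P) - m < oce \<phi> P g + e" using \<open>e > 0\<close> by (rule g.near_oce)
    then show "oce \<phi> P (\<lambda>x. g x - b) \<le> oce \<phi> P g - b + e"
      using g'.oce_le[of "m + b"] by (simp add: algebra_simps)
  qed
  have "oce \<phi> P f \<le> oce \<phi> P (\<lambda>x. f x - a) + a"
  proof -
    have "oce \<phi> P (\<lambda>x. (f x - a) - (- a)) \<le> oce \<phi> P (\<lambda>x. f x - a) - (- a)"
    proof (rule le)
      show "\<bar>f x - a\<bar> \<le> C + \<bar>a\<bar>" if "x \<in> space P" for x using assms(3)[OF that] by linarith
    qed (use assms(2) in measurable)
    then show ?thesis by simp
  qed
  with le[OF assms(2,3), of a] show ?thesis by simp
qed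

text \<open>The inductive step of the measurable selection: at each \<open>x\<close> the better of the old choice and
  the new candidate \<open>h (Suc N)\<close> is kept. Candidates are shifted to have certainty equivalent 0.\<close>
lemma kernel_selection:
  fixes K\<mu> K\<nu> :: "'e::polish_space \<Rightarrow> 'f::polish_space measure" and h :: "nat \<Rightarrow> 'f \<Rightarrow> real"
  assumes K\<mu>: "kernel_on K\<mu>" and K\<nu>: "kernel_on K\<nu>"
    and h [measurable]: "\<And>n. h n \<in> borel_measurable borel" and h_bound: "\<And>n x. \<bar>h n x\<bar> \<le> B n"
    and h_0: "\<And>x. h 0 x = 0"
  shows "\<exists>H C. (\<lambda>(x, y). H x y) \<in> borel_measurable (borel \<Otimes>\<^sub>M borel) \<and> (\<forall>x y. \<bar>H x y\<bar> \<le> C)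
    \<and> (\<forall>x. oce \<phi> (K\<mu> x) (H x) = 0)
    \<and> (\<forall>x. \<forall>n\<le>N. (\<integral>y. h n y \<partial>K\<nu> x) - oce \<phi> (K\<mu> x) (h n) \<le> (\<integral>y. H x y \<partial>K\<nu> x))"
proof (induction N)
  case 0
  have "oce \<phi> (K\<mu> x) (\<lambda>y. 0) = 0" for x
  proof -
    interpret oce_function_prob \<phi> "K\<mu> x" "\<lambda>y. 0" 0
      using kernel_onD(2)[OF K\<mu>, of x]
      by (intro oce_function_prob.intro oce_function_axioms oce_function_prob_axioms.intro) auto
    show ?thesis using oce_bound by simp
  qed
  moreover have "h 0 = (\<lambda>y. 0)" using h_0 by (simp add: fun_eq_iff)
  ultimately show ?case by (intro exI[of _ "\<lambda>x y. 0"] exI[of _ "0"]) simp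
next
  case (Suc N)
  note [measurable] = kernel_onD(1)[OF K\<mu>] kernel_onD(1)[OF K\<nu>]
  obtain H C where H [measurable]: "(\<lambda>(x, y). H x y) \<in> borel_measurable (borel \<Otimes>\<^sub>M borel)"
    and H_bound: "\<And>x y. \<bar>H x y\<bar> \<le> C" and H_oce: "\<And>x. oce \<phi> (K\<mu> x) (H x) = 0"
    and H_ge: "\<And>x n. n \<le> N \<Longrightarrow> (\<integral>y. h n y \<partial>K\<nu> x) - oce \<phi> (K\<mu> x) (h n) \<le> (\<integral>y. H x y \<partial>K\<nu> x)"
    using Suc.IH by blast
  define c where "c x = oce \<phi> (K\<mu> x) (h (Suc N))" for x
  define d where "d x = (\<integral>y. h (Suc N) y \<partial>K\<nu> x) - c x" for x
  \<comment> \<open>The switching set is Borel because the two kernel integrals and the certainty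
    equivalent are measurable in \<open>x\<close>.\<close>
  define Q where "Q x \<longleftrightarrow> d x > (\<integral>y. H x y \<partial>K\<nu> x)" for x
  define H' where "H' x y = (if Q x then h (Suc N) y - c x else H x y)" for x y
  have c [measurable]: "c \<in> borel_measurable borel"
    unfolding c_def by (rule oce_measurable[OF _ kernel_onD(1,2)[OF K\<mu>]]) measurable
  have i [measurable]: "(\<lambda>x. \<integral>y. h (Suc N) y \<partial>K\<nu> x) \<in> borel_measurable borel"
    by (rule integral_measurable_kernel[OF _ kernel_onD(1)[OF K\<nu>]]) measurable
  have [measurable]: "(\<lambda>x. \<integral>y. H x y \<partial>K\<nu> x) \<in> borel_measurable borel"
    by (rule integral_measurable_kernel[OF H kernel_onD(1)[OF K\<nu>]])
  have [measurable]: "Measurable.pred borel Q" unfolding Q_def d_def by measurable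
  have h_\<mu>: "h n \<in> borel_measurable (K\<mu> x)" "h n \<in> borel_measurable (K\<nu> x)" for n x
    by (simp_all cong: measurable_cong_sets add: kernel_onD(3)[OF K\<mu>] kernel_onD(3)[OF K\<nu>])
  have c_bound: "\<bar>c x\<bar> \<le> B (Suc N)" for x
  proof -
    interpret oce_function_prob \<phi> "K\<mu> x" "h (Suc N)" "B (Suc N)"
      using kernel_onD(2)[OF K\<mu>, of x] h_\<mu> h_bound
      by (intro oce_function_prob.intro oce_function_axioms oce_function_prob_axioms.intro)
    show ?thesis unfolding c_def by (rule oce_bound)
  qed
  have H'_int: "(\<integral>y. H' x y \<partial>K\<nu> x) = max (d x) (\<integral>y. H x y \<partial>K\<nu> x)" for x
  proof (cases "Q x")
    case True
    interpret prob_space "K\<nu> x" by (rule kernel_onD(2)[OF K\<nu>])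
    have "integrable (K\<nu> x) (h (Suc N))"
      using h_bound h_\<mu> by (intro integrable_const_bound[where B = "B (Suc N)"]) auto
    then have "(\<integral>y. h (Suc N) y - c x \<partial>K\<nu> x) = d x" by (simp add: d_def prob_space)
    with True show ?thesis by (simp add: H'_def Q_def max_def)
  next
    case False
    then show ?thesis by (simp add: H'_def Q_def max_def)
  qed
  show ?case
  \<comment> \<open>The bound grows with \<open>N\<close>, so bounded test functions result only
    from finitely many candidates; the passage to all of them is left to monotone
    convergence.\<close>
  proof (intro exI[of _ H'] exI[of _ "C + 2 * B (Suc N)"] conjI allI impI)
    show "(\<lambda>(x, y). H' x y) \<in> borel_measurable (borel \<Otimes>\<^sub>M borel)"
      unfolding H'_def by measurable
    show "\<bar>H' x y\<bar> \<le> C + 2 * B (Suc N)" for x y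
      using H_bound[of x y] h_bound[of "Suc N" y] c_bound[of x] unfolding H'_def by auto
    show "oce \<phi> (K\<mu> x) (H' x) = 0" for x
    proof (cases "Q x")
      case True
      then have "H' x = (\<lambda>y. h (Suc N) y - c x)" by (simp add: H'_def fun_eq_iff)
      then show ?thesis
        using oce_diff_const[OF kernel_onD(2)[OF K\<mu>] h_\<mu>(1) h_bound] by (simp add: c_def)
    next
      case False
      then have "H' x = H x" by (simp add: H'_def fun_eq_iff)
      then show ?thesis by (simp add: H_oce)
    qed
    show "(\<integral>y. h n y \<partial>K\<nu> x) - oce \<phi> (K\<mu> x) (h n) \<le> (\<integral>y. H' x y \<partial>K\<nu> x)" if "n \<le> Suc N" for x n
    proof (cases "n = Suc N")
      case True
      then show ?thesis unfolding H'_int by (simp add: d_def c_def)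
    next
      case False
      with that H_ge[of n x] show ?thesis unfolding H'_int by simp
    qed
  qed
qed

section \<open>Gluing the selected test functions\<close>

lemma div_superadditiveI:
  assumes mult: "\<And>x y. 0 \<le> x \<Longrightarrow> 0 \<le> y \<Longrightarrow>
      ereal y * conj_fun \<phi> x + ereal x * conj_fun \<phi> y \<le> conj_fun \<phi> (x * y)"
  shows "div_superadditive \<phi> TYPE('e::polish_space) TYPE('f::polish_space)"
  unfolding div_superadditive_def
proof (intro allI impI)
  fix \<mu> \<nu> :: "'e measure" and K\<mu> K\<nu> :: "'e \<Rightarrow> 'f measure"
  assume \<mu>: "prob_on \<mu>" and \<nu>: "prob_on \<nu>" and K\<mu>: "kernel_on K\<mu>" and K\<nu>: "kernel_on K\<nu>"
  define T where "T = ind_div \<phi> (mix \<nu> K\<nu>) (mix \<mu> K\<mu>)"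
  define I where "I = (\<integral>\<^sup>+ x. e2ennreal (ind_div \<phi> (K\<nu> x) (K\<mu> x)) \<partial>\<nu>)"
  have sets: "sets \<nu> = sets borel" "sets \<mu> = sets borel" using \<nu> \<mu> by (auto simp: prob_on_def)
  interpret \<nu>: prob_space \<nu> using \<nu> by (simp add: prob_on_def)
  obtain h :: "nat \<Rightarrow> 'f \<Rightarrow> real" and B where
    h [measurable]: "\<And>n. h n \<in> borel_measurable borel" and h_bound: "\<And>n x. \<bar>h n x\<bar> \<le> B n" and h_0: "\<And>x. h 0 x = 0"
    and h_SUP: "\<And>\<nu> \<mu>. prob_on \<nu> \<Longrightarrow> prob_on \<mu> \<Longrightarrow>
      ind_div \<phi> \<nu> \<mu> \<le> (SUP n. ereal ((\<integral>x. h n x \<partial>\<nu>) - oce \<phi> \<mu> (h n)))"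
    by (rule ind_div_eq_SUP) blast
  define d where "d n x = (\<integral>y. h n y \<partial>K\<nu> x) - oce \<phi> (K\<mu> x) (h n)" for n x
  have d [measurable]: "d n \<in> borel_measurable \<nu>" for n
  proof -
    have "(\<lambda>x. oce \<phi> (K\<mu> x) (h n)) \<in> borel_measurable borel"
      by (rule oce_measurable[OF _ kernel_onD(1,2)[OF K\<mu>]]) measurable
    moreover have "(\<lambda>x. \<integral>y. h n y \<partial>K\<nu> x) \<in> borel_measurable borel"
      by (rule integral_measurable_kernel[OF _ kernel_onD(1)[OF K\<nu>]]) measurable
    ultimately have "d n \<in> borel_measurable borel" unfolding d_def by measurable
    then show ?thesis by (simp cong: measurable_cong_sets add: sets)
  qed
  \<comment> \<open>The finite stage: a single test function \<open>g\<close> stands for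
    alpha(nu|mu) and the candidates up to \<open>N\<close> for the fibre divergences. Suprema over
    \<open>N\<close> and then over \<open>g\<close> remain to be taken.\<close>
  have le: "ereal ((\<integral>x. g x \<partial>\<nu>) - oce \<phi> \<mu> g) + enn2ereal (\<integral>\<^sup>+ x. (SUP n\<in>{..N}. ennreal (d n x)) \<partial>\<nu>) \<le> T"
    if g: "g \<in> borel_measurable borel" and g_bound: "\<And>x. \<bar>g x\<bar> \<le> A" for g A N
  proof -
    obtain H C where H: "(\<lambda>(x, y). H x y) \<in> borel_measurable (borel \<Otimes>\<^sub>M borel)"
      and H_bound: "\<And>x y. \<bar>H x y\<bar> \<le> C" and H_oce: "\<And>x. oce \<phi> (K\<mu> x) (H x) = 0"
      and H_ge: "\<And>x n. n \<le> N \<Longrightarrow> d n x \<le> (\<integral>y. H x y \<partial>K\<nu> x)"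
      using kernel_selection[where h = h and B = B, OF K\<mu> K\<nu> h h_bound h_0, of N] unfolding d_def by blast
    define u where "u = (\<lambda>(x, y). g x + H x y)"
    note [measurable] = g H
    have "u \<in> borel_measurable (borel \<Otimes>\<^sub>M borel)" unfolding u_def by measurable
    then have u: "u \<in> borel_measurable borel" by (simp add: borel_prod)
    have u_bound: "\<bar>u z\<bar> \<le> A + C" for z
      using g_bound[of "fst z"] H_bound[of "fst z" "snd z"] by (simp add: u_def case_prod_beta)
    interpret D: oce_disintegration \<phi> "mix \<mu> K\<mu>" u \<mu> K\<mu> borel "\<lambda>x y. u (x, y)" "A + C"
      by (rule oce_disintegration_mix[OF \<mu> K\<mu> oce_function_axioms u u_bound])
    have H_x [measurable]: "H x \<in> borel_measurable borel" for x
      using measurable_Pair2[OF H, of x] by simp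
    have H_K: "H x \<in> borel_measurable (K\<mu> x)" "H x \<in> borel_measurable (K\<nu> x)" for x
      by (simp_all cong: measurable_cong_sets add: kernel_onD(3)[OF K\<mu>] kernel_onD(3)[OF K\<nu>])
    \<comment> \<open>\<open>H x\<close> was normalized to certainty equivalent 0, so adding the
      constant \<open>g x\<close> gives exactly \<open>g x\<close>.\<close>
    have cond: "D.cond = g"
    proof
      fix x
      have "D.cond x = oce \<phi> (K\<mu> x) (\<lambda>y. H x y - (- g x))"
        unfolding D.cond_def by (simp add: u_def add.commute)
      then show "D.cond x = g x"
        using oce_diff_const[OF kernel_onD(2)[OF K\<mu>] H_K(1) H_bound, of x "- g x"]
        by (simp add: H_oce)
    qed
    define R where "R x = (\<integral>y. H x y \<partial>K\<nu> x)" for x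
    have R: "R \<in> borel_measurable \<nu>"
      using integral_measurable_kernel[OF H kernel_onD(1)[OF K\<nu>]]
      unfolding R_def[abs_def] by (simp cong: measurable_cong_sets add: sets)
    have int_H: "integrable (K\<nu> x) (H x)" for x
    proof -
      interpret prob_space "K\<nu> x" by (rule kernel_onD(2)[OF K\<nu>])
      show ?thesis by (rule integrable_const_bound[where B = C]) (simp_all add: H_bound H_K)
    qed
    have R_bound: "\<bar>R x\<bar> \<le> C" for x
    proof -
      interpret prob_space "K\<nu> x" by (rule kernel_onD(2)[OF K\<nu>])
      have "norm (R x) \<le> (\<integral>y. norm (H x y) \<partial>K\<nu> x)" unfolding R_def by simp
      also have "\<dots> \<le> (\<integral>y. C \<partial>K\<nu> x)"
        using int_H H_bound by (intro integral_mono) auto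
      finally show ?thesis by (simp add: prob_space)
    qed
    have int_R: "integrable \<nu> R" by (rule \<nu>.integrable_const_bound[where B = C]) (simp_all add: R_bound R)
    have int_g: "integrable \<nu> g"
      by (rule \<nu>.integrable_const_bound[where B = A])
        (simp_all cong: measurable_cong_sets add: g_bound g sets)
    have u_int: "(\<integral>z. u z \<partial>mix \<nu> K\<nu>) = (\<integral>x. g x \<partial>\<nu>) + (\<integral>x. R x \<partial>\<nu>)"
    proof -
      have "(\<integral>y. u (x, y) \<partial>K\<nu> x) = g x + R x" for x
      proof -
        interpret prob_space "K\<nu> x" by (rule kernel_onD(2)[OF K\<nu>])
        show ?thesis using int_H[of x] by (simp add: u_def R_def prob_space)
      qed
      then show ?thesis
        using int_R int_g by (simp add: integral_mix[OF \<nu> K\<nu> u u_bound])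
    qed
    \<comment> \<open>The zero function is among the candidates. Nonnegativity makes the
      \<open>ennreal\<close> integral of \<open>R\<close> agree with its Bochner integral.\<close>
    have R_nonneg: "0 \<le> R x" for x
    proof -
      have "h 0 = (\<lambda>y. 0)" using h_0 by (simp add: fun_eq_iff)
      interpret z: oce_function_prob \<phi> "K\<mu> x" "\<lambda>y. 0" 0
        using kernel_onD(2)[OF K\<mu>, of x]
        by (intro oce_function_prob.intro oce_function_axioms oce_function_prob_axioms.intro) auto
      have "d 0 x = 0" using z.oce_bound \<open>h 0 = (\<lambda>y. 0)\<close> by (simp add: d_def)
      with H_ge[of 0 x] show ?thesis by (simp add: R_def)
    qed
    have "(\<integral>\<^sup>+ x. (SUP n\<in>{..N}. ennreal (d n x)) \<partial>\<nu>) \<le> (\<integral>\<^sup>+ x. ennreal (R x) \<partial>\<nu>)"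
      using H_ge by (intro nn_integral_mono SUP_least ennreal_leI) (simp add: R_def)
    also have "\<dots> = ennreal (\<integral>x. R x \<partial>\<nu>)"
      by (intro nn_integral_eq_integral int_R) (simp add: R_nonneg)
    finally have "enn2ereal (\<integral>\<^sup>+ x. (SUP n\<in>{..N}. ennreal (d n x)) \<partial>\<nu>) \<le> enn2ereal (ennreal (\<integral>x. R x \<partial>\<nu>))"
      by (simp add: less_eq_ennreal.rep_eq)
    then have "enn2ereal (\<integral>\<^sup>+ x. (SUP n\<in>{..N}. ennreal (d n x)) \<partial>\<nu>) \<le> ereal (\<integral>x. R x \<partial>\<nu>)"
      by (simp add: enn2ereal_ennreal R_nonneg)
    then have "ereal ((\<integral>x. g x \<partial>\<nu>) - oce \<phi> \<mu> g) + enn2ereal (\<integral>\<^sup>+ x. (SUP n\<in>{..N}. ennreal (d n x)) \<partial>\<nu>)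
        \<le> ereal ((\<integral>x. g x \<partial>\<nu>) - oce \<phi> \<mu> g) + ereal (\<integral>x. R x \<partial>\<nu>)"
      by (rule add_left_mono)
    also have "oce \<phi> (mix \<mu> K\<mu>) u \<le> oce \<phi> \<mu> D.cond"
      by (rule D.oce_le_oce_cond) (rule mult)
    then have "ereal ((\<integral>x. g x \<partial>\<nu>) - oce \<phi> \<mu> g) + ereal (\<integral>x. R x \<partial>\<nu>)
        \<le> ereal ((\<integral>z. u z \<partial>mix \<nu> K\<nu>) - oce \<phi> (mix \<mu> K\<mu>) u)"
      by (simp add: u_int cond)
    also have "\<dots> \<le> T" unfolding T_def by (rule ind_div_upper[OF u u_bound])
    finally show ?thesis .
  qed
  \<comment> \<open>Maxima over initial segments form an increasing sequence, as monotone
    convergence requires.\<close>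
  have I_le: "I \<le> (SUP N. \<integral>\<^sup>+ x. (SUP n\<in>{..N}. ennreal (d n x)) \<partial>\<nu>)"
  proof -
    have "e2ennreal (ind_div \<phi> (K\<nu> x) (K\<mu> x)) \<le> (SUP N. SUP n\<in>{..N}. ennreal (d n x))" for x
    proof -
      have "ereal (d n x) \<le> enn2ereal (SUP N. SUP n\<in>{..N}. ennreal (d n x))" for n
      proof -
        have "ennreal (d n x) \<le> (SUP N. SUP n\<in>{..N}. ennreal (d n x))"
          by (rule SUP_upper2[of n]) (auto intro: SUP_upper)
        then have "enn2ereal (ennreal (d n x)) \<le> enn2ereal (SUP N. SUP n\<in>{..N}. ennreal (d n x))"
          by (simp add: less_eq_ennreal.rep_eq)
        moreover have "ereal (d n x) \<le> enn2ereal (ennreal (d n x))"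
          by (cases "0 \<le> d n x") (simp_all add: enn2ereal_ennreal ennreal_neg zero_ennreal.rep_eq)
        ultimately show ?thesis by (rule order_trans[rotated])
      qed
      then have "ind_div \<phi> (K\<nu> x) (K\<mu> x) \<le> enn2ereal (SUP N. SUP n\<in>{..N}. ennreal (d n x))"
        using h_SUP[OF kernel_onD(4)[OF K\<nu>] kernel_onD(4)[OF K\<mu>], of x x] unfolding d_def
        by (meson SUP_least order_trans)
      from e2ennreal_mono[OF this] show ?thesis by simp
    qed
    then have "I \<le> (\<integral>\<^sup>+ x. (SUP N. SUP n\<in>{..N}. ennreal (d n x)) \<partial>\<nu>)"
      unfolding I_def by (rule nn_integral_mono)
    also have "\<dots> = (SUP N. \<integral>\<^sup>+ x. (SUP n\<in>{..N}. ennreal (d n x)) \<partial>\<nu>)"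
    proof (rule nn_integral_monotone_convergence_SUP)
      show "incseq (\<lambda>N x. SUP n\<in>{..N}. ennreal (d n x))"
        by (intro incseq_SucI le_funI SUP_subset_mono) auto
    qed measurable
    finally show ?thesis .
  qed
  have "ereal ((\<integral>x. g x \<partial>\<nu>) - oce \<phi> \<mu> g) + enn2ereal I \<le> T"
    if g: "g \<in> borel_measurable borel" and g_bound: "\<And>x. \<bar>g x\<bar> \<le> A" for g A
  proof -
    let ?v = "(\<integral>x. g x \<partial>\<nu>) - oce \<phi> \<mu> g"
    \<comment> \<open>The finite number \<open>?v\<close> is moved to the right so that the supremum
      over \<open>N\<close> can be taken in \<open>ennreal\<close>; \<open>T - ereal ?v\<close> is
      nonnegative and so survives \<open>e2ennreal\<close> unchanged.\<close>
    have *: "enn2ereal (\<integral>\<^sup>+ x. (SUP n\<in>{..N}. ennreal (d n x)) \<partial>\<nu>) \<le> T - ereal ?v" for N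
      using le[OF g g_bound, of N] by (simp add: ereal_le_minus add.commute)
    then have "0 \<le> T - ereal ?v" by (rule order_trans[OF enn2ereal_nonneg])
    have "(SUP N. \<integral>\<^sup>+ x. (SUP n\<in>{..N}. ennreal (d n x)) \<partial>\<nu>) \<le> e2ennreal (T - ereal ?v)"
      using e2ennreal_mono[OF *] by (intro SUP_least) simp
    with I_le have "I \<le> e2ennreal (T - ereal ?v)" by (rule order_trans)
    then have "enn2ereal I \<le> T - ereal ?v"
      using \<open>0 \<le> T - ereal ?v\<close> by (simp add: less_eq_ennreal.rep_eq enn2ereal_e2ennreal)
    then show ?thesis by (simp add: ereal_le_minus add.commute)
  qed
  then have v: "ereal ((\<integral>x. g x \<partial>\<nu>) - oce \<phi> \<mu> g) + enn2ereal I \<le> T"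
    if "g \<in> {g. g \<in> borel_measurable borel \<and> bounded (range g)}" for g
    using that by (auto simp: bounded_iff)
  have "ind_div \<phi> \<nu> \<mu> + enn2ereal I
      = (SUP g\<in>{g. g \<in> borel_measurable borel \<and> bounded (range g)}. ereal ((\<integral>x. g x \<partial>\<nu>) - oce \<phi> \<mu> g) + enn2ereal I)"
    unfolding ind_div_def
  proof (rule SUP_ereal_add_left[symmetric])
    have "(\<lambda>x. 0) \<in> {g :: 'e \<Rightarrow> real. g \<in> borel_measurable borel \<and> bounded (range g)}" by simp
    then show "{g :: 'e \<Rightarrow> real. g \<in> borel_measurable borel \<and> bounded (range g)} \<noteq> {}" by blast
  qed auto
  also have "\<dots> \<le> T" by (rule SUP_least) (rule v)
  finally show "ind_div \<phi> \<nu> \<mu> + enn2ereal (\<integral>\<^sup>+ x. e2ennreal (ind_div \<phi> (K\<nu> x) (K\<mu> x)) \<partial>\<nu>)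
      \<le> ind_div \<phi> (mix \<nu> K\<nu>) (mix \<mu> K\<mu>)"
    by (simp add: T_def I_def)
qed

end

theorem theorem5p5:
  fixes \<phi> :: "real \<Rightarrow> real" and M :: "'a::polish_space measure"
  assumes "convex_on UNIV \<phi>" and "mono \<phi>" and "conj_fun \<phi> 1 = 0"
    and "prob_space M" and "sets M = sets (borel :: 'a measure)" and "nonatomic M"
  shows "((\<forall>x y. 0 \<le> x \<longrightarrow> 0 \<le> y \<longrightarrow>
              ereal y * conj_fun \<phi> x + ereal x * conj_fun \<phi> y \<le> conj_fun \<phi> (x * y))
           \<longrightarrow> div_superadditive \<phi> TYPE('e::polish_space) TYPE('f::polish_space)
               \<and> acceptance_consistent \<phi> M)
       \<and> ((\<forall>x y. 0 \<le> x \<longrightarrow> 0 \<le> y \<longrightarrow>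
              ereal y * conj_fun \<phi> x + ereal x * conj_fun \<phi> y \<ge> conj_fun \<phi> (x * y))
           \<longrightarrow> div_subadditive \<phi> TYPE('e) TYPE('f)
               \<and> rejection_consistent \<phi> M)"
proof -
  interpret oce_function \<phi> using assms(1-3) by unfold_locales
  show ?thesis
    using div_superadditiveI acceptance_consistentI[OF _ assms(4)]
      div_subadditiveI rejection_consistentI[OF _ assms(4)] by blast
qed

end
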